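(* There is an algorithm (the two-dimensional duel-and-sweep algorithm) that solves the two-dimensional order-preserving pattern matching problem for a text $\mathbf{T}$ of size $n\times n$ and a pattern $\mathbf{P}$ of size $m\times m$ in $O(n^2m+m^3)$ time, i.e. it reports all positions $(x,y)$, $1\le x,y\le n-m+1$, with $\mathbf{T}[x\!:\!x+m-1,\,y\!:\!y+m-1]\approx\mathbf{P}$.
   Context: Entries are integers, any two comparable in constant time. Two-dimensional strings are indexed as $\mathbf{S}[x,y]$ with horizontal coordinate $x$ and vertical coordinate $y$; $\mathbf{S}[x\!:\!x+w-1,\,y\!:\!y+h-1]$ denotes the $w\times h$ substring with top-left corner at $(x,y)$. Two two-dimensional strings $\mathbf{S},\mathbf{T}$ of the same size $w\times h$ are order-isomorphic, $\mathbf{S}\approx\mathbf{T}$, if $\mathbf{S}[i_x,i_y]\le\mathbf{S}[j_x,j_y]\iff\mathbf{T}[i_x,i_y]\le\mathbf{T}[j_x,j_y]$ for all $1\le i_x,j_x\le w$, $1\le i_y,j_y\le h$. *)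

theory Defs
  imports Main
begin

section \<open>Two-dimensional strings and order-isomorphism\<close>

text \<open>A \<open>w \<times> h\<close> string is a function \<open>S\<close> of which only the values \<open>S x y\<close> with
  \<open>1 \<le> x \<le> w\<close> (horizontal) and \<open>1 \<le> y \<le> h\<close> (vertical) are meaningful; sizes are passed separately.\<close>

type_synonym string2 = "nat \<Rightarrow> nat \<Rightarrow> int"

text \<open>\<open>substring2 S x y\<close> is the part of \<open>S\<close> with top-left corner \<open>(x, y)\<close>, re-indexed from 1; its size
  is determined by the context.\<close>

definition substring2 :: "string2 \<Rightarrow> nat \<Rightarrow> nat \<Rightarrow> string2" where
  "substring2 S x y = (\<lambda>i j. S (x + i - 1) (y + j - 1))"

definition order_iso :: "nat \<Rightarrow> nat \<Rightarrow> string2 \<Rightarrow> string2 \<Rightarrow> bool" where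
  "order_iso w h S T \<longleftrightarrow>
     (\<forall>ix\<in>{1..w}. \<forall>jx\<in>{1..w}. \<forall>iy\<in>{1..h}. \<forall>jy\<in>{1..h}.
        S ix iy \<le> S jx jy \<longleftrightarrow> T ix iy \<le> T jx jy)"

text \<open>The condition \<open>x + m \<le> n + 1\<close> says \<open>x \<le> n - m + 1\<close> without truncated subtraction.\<close>

definition op_matches :: "nat \<Rightarrow> nat \<Rightarrow> string2 \<Rightarrow> string2 \<Rightarrow> (nat \<times> nat) set" where
  "op_matches n m T P =
     {(x, y). 1 \<le> x \<and> x + m \<le> n + 1 \<and> 1 \<le> y \<and> y + m \<le> n + 1 \<and>
              order_iso m m (substring2 T x y) P}"


section \<open>The machine model\<close>

text \<open>Algorithms are programs of a unit-cost word RAM, presented as a structured language with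
  finitely many named word variables and named word arrays per program.
  All words are below a bound \<open>W\<close>; an operation whose result does not fit (as well as
  an access outside the text or the pattern) has no value, and a program performing it has no
  execution. The entries of the two input strings are arbitrary integers. They are read-only,
  are not words, and can only be compared with each other, at unit cost.\<close>

type_synonym vname = string

datatype binop = Add | Sub | Mul | Div | Mod

datatype aexp =
    Const nat
  | Var vname
  | Elem vname aexp
  | Bin binop aexp aexp

datatype entry =
    TextAt aexp aexp
  | PatAt aexp aexp

datatype bexp =
    Less aexp aexp
  | EntryLe entry entry
  | Not bexp
  | And bexp bexp

datatype com =
    Skip
  | Assign vname aexp
  | Store vname aexp aexp
  | Report aexp aexp
  | Seq com com
  | If bexp com com
  | While bexp com

record input =
  text_size :: nat
  pat_size :: nat
  text_string :: string2
  pat_string :: string2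

record state =
  vars :: "vname \<Rightarrow> nat"
  arrays :: "vname \<Rightarrow> nat \<Rightarrow> nat"
  reported :: "(nat \<times> nat) list"

definition init_state :: "input \<Rightarrow> state" where
  "init_state I =
     \<lparr>vars = (\<lambda>_. 0)(''n'' := text_size I, ''m'' := pat_size I),
      arrays = (\<lambda>_ _. 0),
      reported = []\<rparr>"

text \<open>Subtraction is truncated at 0, and \<open>a div 0 = 0\<close>, \<open>a mod 0 = a\<close>.\<close>

fun binop_val :: "binop \<Rightarrow> nat \<Rightarrow> nat \<Rightarrow> nat" where
  "binop_val Add a b = a + b"
| "binop_val Sub a b = a - b"
| "binop_val Mul a b = a * b"
| "binop_val Div a b = a div b"
| "binop_val Mod a b = a mod b"

definition word :: "nat \<Rightarrow> nat \<Rightarrow> nat option" where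
  "word W v = (if v < W then Some v else None)"

fun aval :: "nat \<Rightarrow> aexp \<Rightarrow> state \<Rightarrow> nat option" where
  "aval W (Const k) s = word W k"
| "aval W (Var x) s = word W (vars s x)"
| "aval W (Elem a e) s =
     (case aval W e s of None \<Rightarrow> None | Some i \<Rightarrow> word W (arrays s a i))"
| "aval W (Bin f e1 e2) s =
     (case (aval W e1 s, aval W e2 s) of
        (Some v1, Some v2) \<Rightarrow> word W (binop_val f v1 v2)
      | _ \<Rightarrow> None)"

definition lookup :: "nat \<Rightarrow> string2 \<Rightarrow> nat option \<Rightarrow> nat option \<Rightarrow> int option" where
  "lookup l S u v =
     (case (u, v) of
        (Some x, Some y) \<Rightarrow>
          (if 1 \<le> x \<and> x \<le> l \<and> 1 \<le> y \<and> y \<le> l then Some (S x y) else None)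
      | _ \<Rightarrow> None)"

fun entry_val :: "input \<Rightarrow> nat \<Rightarrow> entry \<Rightarrow> state \<Rightarrow> int option" where
  "entry_val I W (TextAt e1 e2) s =
     lookup (text_size I) (text_string I) (aval W e1 s) (aval W e2 s)"
| "entry_val I W (PatAt e1 e2) s =
     lookup (pat_size I) (pat_string I) (aval W e1 s) (aval W e2 s)"

text \<open>Conjunction is short-circuit.\<close>

fun bval :: "input \<Rightarrow> nat \<Rightarrow> bexp \<Rightarrow> state \<Rightarrow> bool option" where
  "bval I W (Less e1 e2) s =
     (case (aval W e1 s, aval W e2 s) of
        (Some v1, Some v2) \<Rightarrow> Some (v1 < v2)
      | _ \<Rightarrow> None)"
| "bval I W (EntryLe r1 r2) s =
     (case (entry_val I W r1 s, entry_val I W r2 s) of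
        (Some v1, Some v2) \<Rightarrow> Some (v1 \<le> v2)
      | _ \<Rightarrow> None)"
| "bval I W (Not b) s = map_option HOL.Not (bval I W b s)"
| "bval I W (And b1 b2) s =
     (case bval I W b1 s of
        None \<Rightarrow> None
      | Some False \<Rightarrow> Some False
      | Some True \<Rightarrow> bval I W b2 s)"

text \<open>Evaluating an expression costs one step per node of its syntax tree (for a short-circuit
  conjunction, too, both sides are charged).\<close>

fun acost :: "aexp \<Rightarrow> nat" where
  "acost (Const k) = 1"
| "acost (Var x) = 1"
| "acost (Elem a e) = 1 + acost e"
| "acost (Bin f e1 e2) = 1 + acost e1 + acost e2"

fun entry_cost :: "entry \<Rightarrow> nat" where
  "entry_cost (TextAt e1 e2) = 1 + acost e1 + acost e2"
| "entry_cost (PatAt e1 e2) = 1 + acost e1 + acost e2"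

fun bcost :: "bexp \<Rightarrow> nat" where
  "bcost (Less e1 e2) = 1 + acost e1 + acost e2"
| "bcost (EntryLe r1 r2) = 1 + entry_cost r1 + entry_cost r2"
| "bcost (Not b) = 1 + bcost b"
| "bcost (And b1 b2) = 1 + bcost b1 + bcost b2"

text \<open>\<open>exec I W c s t s'\<close>: on input \<open>I\<close> and with word bound \<open>W\<close>, program \<open>c\<close> started in state \<open>s\<close>
  terminates in state \<open>s'\<close> after \<open>t\<close> steps.\<close>

inductive exec :: "input \<Rightarrow> nat \<Rightarrow> com \<Rightarrow> state \<Rightarrow> nat \<Rightarrow> state \<Rightarrow> bool"
  for I :: input and W :: nat where
  Skip: "exec I W Skip s 1 s"
| Assign: "aval W e s = Some v \<Longrightarrow>
    exec I W (Assign x e) s (1 + acost e) (s\<lparr>vars := (vars s)(x := v)\<rparr>)"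
| Store: "aval W e1 s = Some i \<Longrightarrow> aval W e2 s = Some v \<Longrightarrow>
    exec I W (Store a e1 e2) s (1 + acost e1 + acost e2)
      (s\<lparr>arrays := (arrays s)(a := (arrays s a)(i := v))\<rparr>)"
| Report: "aval W e1 s = Some x \<Longrightarrow> aval W e2 s = Some y \<Longrightarrow>
    exec I W (Report e1 e2) s (1 + acost e1 + acost e2)
      (s\<lparr>reported := (x, y) # reported s\<rparr>)"
| Seq: "exec I W c1 s t1 s1 \<Longrightarrow> exec I W c2 s1 t2 s2 \<Longrightarrow>
    exec I W (Seq c1 c2) s (1 + t1 + t2) s2"
| IfTrue: "bval I W b s = Some True \<Longrightarrow> exec I W c1 s t s' \<Longrightarrow>
    exec I W (If b c1 c2) s (1 + bcost b + t) s'"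
| IfFalse: "bval I W b s = Some False \<Longrightarrow> exec I W c2 s t s' \<Longrightarrow>
    exec I W (If b c1 c2) s (1 + bcost b + t) s'"
| WhileFalse: "bval I W b s = Some False \<Longrightarrow>
    exec I W (While b c) s (1 + bcost b) s"
| WhileTrue: "bval I W b s = Some True \<Longrightarrow> exec I W c s t1 s1 \<Longrightarrow>
    exec I W (While b c) s1 t2 s2 \<Longrightarrow>
    exec I W (While b c) s (1 + bcost b + t1 + t2) s2"

inductive_cases exec_SkipE: "exec I W Skip s t s'"
inductive_cases exec_AssignE: "exec I W (Assign x e) s t s'"
inductive_cases exec_StoreE: "exec I W (Store a e1 e2) s t s'"
inductive_cases exec_ReportE: "exec I W (Report e1 e2) s t s'"
inductive_cases exec_SeqE: "exec I W (Seq c1 c2) s t s'"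
inductive_cases exec_IfE: "exec I W (If b c1 c2) s t s'"
inductive_cases exec_WhileE: "exec I W (While b c) s t s'"

text \<open>The machine is deterministic, so existence of an execution means that \<^emph>\<open>the\<close> run of the program
  terminates, with the given step count and result.\<close>

lemma exec_deterministic:
  assumes "exec I W c s t s'" and "exec I W c s u s''"
  shows "u = t \<and> s'' = s'"
  using assms
proof (induction arbitrary: u s'' rule: exec.induct)
  case (Skip s)
  then show ?case by (auto elim: exec_SkipE)
next
  case (Assign e s v x)
  then show ?case by (auto elim: exec_AssignE)
next
  case (Store e1 s i e2 v a)
  then show ?case by (auto elim!: exec_StoreE)
next
  case (Report e1 s x e2 y)
  then show ?case by (auto elim!: exec_ReportE)
next
  case (Seq c1 s t1 s1 c2 t2 s2)
  from Seq.prems show ?case by (rule exec_SeqE) (auto dest: Seq.IH)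
next
  case (IfTrue b s c1 t s' c2)
  from IfTrue.prems show ?case by (rule exec_IfE) (use IfTrue.hyps in \<open>auto dest: IfTrue.IH\<close>)
next
  case (IfFalse b s c2 t s' c1)
  from IfFalse.prems show ?case by (rule exec_IfE) (use IfFalse.hyps in \<open>auto dest: IfFalse.IH\<close>)
next
  case (WhileFalse b s c)
  from WhileFalse.prems show ?case by (rule exec_WhileE) (use WhileFalse.hyps in auto)
next
  case (WhileTrue b s c t1 s1 t2 s2)
  from WhileTrue.prems show ?case
    by (rule exec_WhileE) (use WhileTrue.hyps in \<open>auto dest: WhileTrue.IH\<close>)
qed

text \<open>One fixed program solves the problem on all inputs, in time \<open>O(f n m)\<close> with a constant uniform
  in \<open>n\<close> and \<open>m\<close>, on words of \<open>k * log (n + m)\<close> bits for a constant \<open>k\<close>.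
  The set of reported pairs must be exactly the set of matches.\<close>

definition solves_oppm2_in_time :: "com \<Rightarrow> (nat \<Rightarrow> nat \<Rightarrow> nat) \<Rightarrow> bool" where
  "solves_oppm2_in_time prog f \<longleftrightarrow>
     (\<exists>C k. \<forall>n\<ge>1. \<forall>m\<ge>1. \<forall>T P.
        let I = \<lparr>text_size = n, pat_size = m, text_string = T, pat_string = P\<rparr> in
        \<exists>t s. exec I ((n + m) ^ k) prog (init_state I) t s \<and>
              t \<le> C * f n m \<and>
              set (reported s) = op_matches n m T P)"

end

theory Submission
  imports Defs
begin

text \<open>
  Fix a horizontal strip of \<open>m\<close> consecutive rows of the text and read every column of the strip, and
  every column of the pattern, as one letter. Order-isomorphism is an equivalence relation on strings of
  columns that is inherited by aligned substrings, so the shifts of Knuth-Morris-Pratt are sound for it: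
  if a matched prefix cannot be extended, one may pass to the least shift at which the overlap of the
  pattern with itself reaches the end of the matched part. Each strip then needs \<open>O(n)\<close> letter tests.

  A letter test has to decide in \<open>O(m)\<close> time whether an order-isomorphism of \<open>j\<close> columns extends to
  \<open>j + 1\<close> columns. It suffices to compare each entry of the new column with its two neighbours in the
  sorted order of the first \<open>j + 1\<close> pattern columns, because neighbours that both lie in the first \<open>j\<close>
  columns agree already. The neighbours are found by sorting all \<open>m\<^sup>2\<close> pattern entries once, extracting
  each minimum in \<open>O(m)\<close> time from the \<open>m\<close> column minima, and by scanning the sorted order once per
  column, in total \<open>O(m\<^sup>3)\<close>. Finding the self-overlaps of the pattern naively takes \<open>O(m\<^sup>2)\<close> letter
  tests, again \<open>O(m\<^sup>3)\<close>.
\<close>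

section \<open>A weakest-precondition calculus with time\<close>

text \<open>A column is not a letter with a fixed identity: whether it matches depends on all
  columns matched before it. The shifts remain sound because their justification never speaks of
  equality of single letters. A column test costs \<open>O(m)\<close> anyway, so after a mismatch
  the next shift may be found by a linear scan over the overlaps, and no failure function has to be
  computed. The machine shapes the rest. An overflow or an access outside the strings leaves a
  program without any execution, so definedness of every expression is proved along with
  correctness: short-circuit conjunctions guard the code for "none", and links at the ends of the
  sorted order point to the code itself. The numbers in the time bounds are mostly rounded up; only
  their independence of \<open>n\<close> and \<open>m\<close> matters.\<close>

definition wp :: "input \<Rightarrow> nat \<Rightarrow> com \<Rightarrow> state \<Rightarrow> (nat \<Rightarrow> state \<Rightarrow> bool) \<Rightarrow> bool" where
  "wp I W c s Q \<longleftrightarrow> (\<exists>t s'. exec I W c s t s' \<and> Q t s')"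

fun written_vars :: "com \<Rightarrow> vname set" where
  "written_vars (Assign x e) = {x}"
| "written_vars (Seq c1 c2) = written_vars c1 \<union> written_vars c2"
| "written_vars (If b c1 c2) = written_vars c1 \<union> written_vars c2"
| "written_vars (While b c) = written_vars c"
| "written_vars _ = {}"

fun written_arrays :: "com \<Rightarrow> vname set" where
  "written_arrays (Store a e1 e2) = {a}"
| "written_arrays (Seq c1 c2) = written_arrays c1 \<union> written_arrays c2"
| "written_arrays (If b c1 c2) = written_arrays c1 \<union> written_arrays c2"
| "written_arrays (While b c) = written_arrays c"
| "written_arrays _ = {}"

fun silent :: "com \<Rightarrow> bool" where
  "silent (Report e1 e2) = False"
| "silent (Seq c1 c2) = (silent c1 \<and> silent c2)"
| "silent (If b c1 c2) = (silent c1 \<and> silent c2)"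
| "silent (While b c) = silent c"
| "silent _ = True"

definition frame :: "com \<Rightarrow> state \<Rightarrow> state \<Rightarrow> bool" where
  "frame c s s' \<longleftrightarrow>
     (\<forall>x. x \<notin> written_vars c \<longrightarrow> vars s' x = vars s x) \<and>
     (\<forall>a. a \<notin> written_arrays c \<longrightarrow> arrays s' a = arrays s a) \<and>
     (silent c \<longrightarrow> reported s' = reported s)"

lemma frame_refl: "frame c s s"
  by (simp add: frame_def)

lemma frame_trans: "frame c s s' \<Longrightarrow> frame c s' s'' \<Longrightarrow> frame c s s''"
  by (simp add: frame_def)

lemma frame_While: "frame (While b c) = frame c"
  by (simp add: frame_def fun_eq_iff)

lemma exec_frame: "exec I W c s t s' \<Longrightarrow> frame c s s'"
  by (induction rule: exec.induct) (auto simp: frame_def)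

text \<open>Every execution supplies its own frame condition, so a specification has to describe
  only what its program writes.\<close>

lemma wp_mono:
  assumes "wp I W c s Q" and "\<And>t s'. frame c s s' \<Longrightarrow> Q t s' \<Longrightarrow> R t s'"
  shows "wp I W c s R"
  using assms exec_frame unfolding wp_def by blast

text \<open>Loops are left out, since unfolding \<open>While\<close> by rewriting would not
  terminate; they are treated by \<open>wp_While\<close>.\<close>

lemma exec_iff:
  "exec I W Skip s t s' \<longleftrightarrow> t = 1 \<and> s' = s"
  "exec I W (Assign x e) s t s' \<longleftrightarrow>
     (\<exists>v. aval W e s = Some v \<and> t = 1 + acost e \<and> s' = s\<lparr>vars := (vars s)(x := v)\<rparr>)"
  "exec I W (Store a e1 e2) s t s' \<longleftrightarrow>
     (\<exists>i v. aval W e1 s = Some i \<and> aval W e2 s = Some v \<and> t = 1 + acost e1 + acost e2 \<and>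
        s' = s\<lparr>arrays := (arrays s)(a := (arrays s a)(i := v))\<rparr>)"
  "exec I W (Report e1 e2) s t s' \<longleftrightarrow>
     (\<exists>x y. aval W e1 s = Some x \<and> aval W e2 s = Some y \<and> t = 1 + acost e1 + acost e2 \<and>
        s' = s\<lparr>reported := (x, y) # reported s\<rparr>)"
  "exec I W (Seq c1 c2) s t s' \<longleftrightarrow>
     (\<exists>t1 s1 t2. exec I W c1 s t1 s1 \<and> exec I W c2 s1 t2 s' \<and> t = 1 + t1 + t2)"
  "exec I W (If b c1 c2) s t s' \<longleftrightarrow>
     (\<exists>v t'. bval I W b s = Some v \<and> exec I W (if v then c1 else c2) s t' s' \<and>
        t = 1 + bcost b + t')"
  by (subst exec.simps; simp; blast?; force)+

lemma wp_Skip: "wp I W Skip s Q = Q 1 s"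
  by (simp add: wp_def exec_iff)

lemma wp_Assign:
  "wp I W (Assign x e) s Q =
     (case aval W e s of None \<Rightarrow> False
      | Some v \<Rightarrow> Q (1 + acost e) (s\<lparr>vars := (vars s)(x := v)\<rparr>))"
  by (auto simp: wp_def exec_iff split: option.split)

lemma wp_Store:
  "wp I W (Store a e1 e2) s Q =
     (case aval W e1 s of None \<Rightarrow> False
      | Some i \<Rightarrow> (case aval W e2 s of None \<Rightarrow> False
      | Some v \<Rightarrow> Q (1 + acost e1 + acost e2)
                    (s\<lparr>arrays := (arrays s)(a := (arrays s a)(i := v))\<rparr>)))"
  by (auto simp: wp_def exec_iff split: option.split)

lemma wp_Report:
  "wp I W (Report e1 e2) s Q =
     (case aval W e1 s of None \<Rightarrow> False
      | Some x \<Rightarrow> (case aval W e2 s of None \<Rightarrow> False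
      | Some y \<Rightarrow> Q (1 + acost e1 + acost e2) (s\<lparr>reported := (x, y) # reported s\<rparr>)))"
  by (auto simp: wp_def exec_iff split: option.split)

lemma wp_Seq:
  "wp I W (Seq c1 c2) s Q =
     wp I W c1 s (\<lambda>t1 s1. wp I W c2 s1 (\<lambda>t2 s2. Q (1 + t1 + t2) s2))"
  unfolding wp_def exec_iff by blast

lemma wp_If:
  "wp I W (If b c1 c2) s Q =
     (case bval I W b s of None \<Rightarrow> False
      | Some v \<Rightarrow> wp I W (if v then c1 else c2) s (\<lambda>t. Q (1 + bcost b + t)))"
  unfolding wp_def exec_iff by (cases "bval I W b s") auto

text \<open>The variant falls by at least one per round, so there are at most
  \<open>\<mu> s0\<close> rounds, each paying \<open>B\<close> for the body and
  \<open>1 + bcost b\<close> for the guard, followed by one last evaluation of the guard. The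
  assumption \<open>guard\<close> is separate because an overflowing guard has no value: not being
  \<open>Some True\<close> does not yet mean \<open>Some False\<close>.\<close>

lemma wp_While:
  assumes "Inv s0"
    and guard: "\<And>s. frame c s0 s \<Longrightarrow> Inv s \<Longrightarrow> bval I W b s \<noteq> None"
    and step: "\<And>s. frame c s0 s \<Longrightarrow> Inv s \<Longrightarrow> bval I W b s = Some True \<Longrightarrow>
                 wp I W c s (\<lambda>t s'. t \<le> B \<and> Inv s' \<and> \<mu> s' < \<mu> s)"
    and post: "\<And>t s. frame c s0 s \<Longrightarrow> Inv s \<Longrightarrow> bval I W b s = Some False \<Longrightarrow>
                 t \<le> \<mu> s0 * (B + 1 + bcost b) + 1 + bcost b \<Longrightarrow> Q t s"
  shows "wp I W (While b c) s0 Q"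
proof -
  have "\<exists>t s'. exec I W (While b c) s t s' \<and> frame c s0 s' \<and> Inv s' \<and>
               bval I W b s' = Some False \<and> t \<le> \<mu> s * (B + 1 + bcost b) + 1 + bcost b"
    if "frame c s0 s" "Inv s" for s
    using that
  proof (induction "\<mu> s" arbitrary: s rule: less_induct)
    case less
    show ?case
    proof (cases "bval I W b s = Some True")
      case True
      from step[OF less.prems True] obtain t s1 where
        s1: "exec I W c s t s1" "t \<le> B" "Inv s1" "\<mu> s1 < \<mu> s"
        unfolding wp_def by blast
      have "frame c s0 s1"
        using exec_frame[OF s1(1)] less.prems(1) frame_trans by blast
      from less.hyps[OF s1(4) this s1(3)] obtain t' s' where
        s': "exec I W (While b c) s1 t' s'" "frame c s0 s'" "Inv s'"
          "bval I W b s' = Some False" "t' \<le> \<mu> s1 * (B + 1 + bcost b) + 1 + bcost b"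
        by blast
      have "exec I W (While b c) s (1 + bcost b + t + t') s'"
        using True s1 s' by (intro exec.WhileTrue)
      moreover have "Suc (\<mu> s1) * (B + 1 + bcost b) \<le> \<mu> s * (B + 1 + bcost b)"
        using s1(4) by (intro mult_right_mono) auto
      then have "1 + bcost b + t + t' \<le> \<mu> s * (B + 1 + bcost b) + 1 + bcost b"
        using s1(2) s'(5) by simp
      ultimately show ?thesis using s' by blast
    next
      case False
      then have "bval I W b s = Some False" using guard[OF less.prems] by auto
      then show ?thesis using less.prems
        using exec.WhileFalse[of I W b s c] by fastforce
    qed
  qed
  from this[OF frame_refl assms(1)] obtain t s' where
    "exec I W (While b c) s0 t s'" "frame c s0 s'" "Inv s'"
    "bval I W b s' = Some False" "t \<le> \<mu> s0 * (B + 1 + bcost b) + 1 + bcost b"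
    by blast
  then show ?thesis
    unfolding wp_def by (intro exI[of _ t] exI[of _ s']) (simp add: post)
qed

lemma word_ok: "v < W \<Longrightarrow> word W v = Some v"
  by (simp add: word_def)

lemmas wp_simps = wp_Skip wp_Assign wp_Store wp_Report wp_Seq wp_If

section \<open>Order-isomorphism of blocks of columns\<close>

definition block_iso :: "nat \<Rightarrow> (nat \<Rightarrow> int) \<Rightarrow> (nat \<Rightarrow> int) \<Rightarrow> bool" where
  "block_iso k A B \<longleftrightarrow> (\<forall>e<k. \<forall>f<k. A e \<le> A f \<longleftrightarrow> B e \<le> B f)"

text \<open>Both directions are compared, so ties must correspond to ties. Agreement alone is not
  transitive, but it is along ascending triples: if \<open>A a \<le> A b \<le> A c\<close> and
  neighbouring pairs agree, then \<open>A c \<le> A a\<close> forces equality throughout, and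
  likewise for \<open>B\<close>.\<close>

definition agree :: "(nat \<Rightarrow> int) \<Rightarrow> (nat \<Rightarrow> int) \<Rightarrow> nat \<Rightarrow> nat \<Rightarrow> bool" where
  "agree A B e f \<longleftrightarrow> (A e \<le> A f \<longleftrightarrow> B e \<le> B f) \<and> (A f \<le> A e \<longleftrightarrow> B f \<le> B e)"

lemma block_iso_0: "block_iso 0 A B"
  by (simp add: block_iso_def)

lemma block_iso_antimono: "block_iso k A B \<Longrightarrow> l \<le> k \<Longrightarrow> block_iso l A B"
  by (simp add: block_iso_def)

lemma block_iso_sym: "block_iso k A B \<Longrightarrow> block_iso k B A"
  by (simp add: block_iso_def)

lemma block_iso_trans: "block_iso k A B \<Longrightarrow> block_iso k B C \<Longrightarrow> block_iso k A C"
  by (simp add: block_iso_def)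

lemma block_iso_shift:
  "block_iso (d + k) A B \<Longrightarrow> block_iso k (\<lambda>e. A (d + e)) (\<lambda>e. B (d + e))"
  by (simp add: block_iso_def)

lemma block_iso_agree: "block_iso k A B \<Longrightarrow> e < k \<Longrightarrow> f < k \<Longrightarrow> agree A B e f"
  by (simp add: block_iso_def agree_def)

text \<open>Links are demanded only of codes from \<open>lo\<close> on, and nothing is demanded of
  the outer links at the two ends of the list.\<close>

definition linked :: "nat \<Rightarrow> (nat \<Rightarrow> nat) \<Rightarrow> (nat \<Rightarrow> nat) \<Rightarrow> nat list \<Rightarrow> bool" where
  "linked lo pr su = successively (\<lambda>a b. (lo \<le> a \<longrightarrow> su a = b) \<and> (lo \<le> b \<longrightarrow> pr b = a))"

text \<open>In the sorted list of all elements of the longer block, two neighbours agree: either both lie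
  in the shorter block, or they were compared as neighbours of a new element. Agreement of neighbours
  spreads to all pairs by transitivity.\<close>

lemma block_iso_extend:
  assumes iso: "block_iso lo A B"
    and set: "set xs = {..<hi}"
    and sorted: "sorted_wrt (\<lambda>a b. A a \<le> A b) xs"
    and links: "linked lo pr su xs"
    and chk: "\<And>e. lo \<le> e \<Longrightarrow> e < hi \<Longrightarrow> agree A B e (pr e) \<and> agree A B e (su e)"
  shows "block_iso hi A B"
proof -
  define R where "R a b \<longleftrightarrow> A a \<le> A b \<and> agree A B a b" for a b
  have "R (xs ! i) (xs ! Suc i)" if "Suc i < length xs" for i
  proof -
    let ?a = "xs ! i" and ?b = "xs ! Suc i"
    have "A ?a \<le> A ?b"
      using sorted that by (simp add: sorted_wrt_iff_nth_less)
    moreover have "?a < hi" "?b < hi"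
      using set that nth_mem[of i xs] nth_mem[of "Suc i" xs] by simp_all
    moreover have "(lo \<le> ?a \<longrightarrow> su ?a = ?b) \<and> (lo \<le> ?b \<longrightarrow> pr ?b = ?a)"
      using links that unfolding linked_def successively_conv_nth by blast
    moreover have "agree A B ?a ?b \<longleftrightarrow> agree A B ?b ?a" by (auto simp: agree_def)
    ultimately show ?thesis
      using block_iso_agree[OF iso, of ?a ?b] chk[of ?a] chk[of ?b] unfolding R_def
      by (metis not_le)
  qed
  then have "successively R xs" by (simp add: successively_conv_nth)
  moreover have "transp R" by (rule transpI) (auto simp: R_def agree_def)
  ultimately have *: "sorted_wrt R xs" by (simp add: successively_conv_sorted_wrt)
  show ?thesis
    unfolding block_iso_def
  proof (intro allI impI)
    fix e f assume "e < hi" "f < hi"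
    then obtain i j where ij: "e = xs ! i" "i < length xs" "f = xs ! j" "j < length xs"
      using set by (metis in_set_conv_nth lessThan_iff)
    consider "i < j" | "i = j" | "j < i" by linarith
    then show "A e \<le> A f \<longleftrightarrow> B e \<le> B f"
    proof cases
      case 1
      then have "R e f" using * ij by (simp add: sorted_wrt_iff_nth_less)
      then show ?thesis unfolding R_def agree_def by blast
    next
      case 2
      then show ?thesis using ij by simp
    next
      case 3
      then have "R f e" using * ij by (simp add: sorted_wrt_iff_nth_less)
      then show ?thesis unfolding R_def agree_def by blast
    qed
  qed
qed

section \<open>Soundness of the Knuth-Morris-Pratt shifts\<close>

text \<open>Columns \<open>d\<close> to \<open>d + z\<close> lie inside the matched part, where
  \<open>B\<close> is order-isomorphic to \<open>A\<close>. By transitivity an occurrence at shift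
  \<open>d\<close> would yield exactly the self-overlap of \<open>A\<close> on \<open>Suc z\<close>
  columns that is excluded.\<close>

lemma shift_mismatch:
  assumes matched: "block_iso (j * m) A B"
    and Z: "\<not> block_iso (Suc z * m) A (\<lambda>e. A (d * m + e))"
    and "d + z < j" and "j \<le> l"
  shows "\<not> block_iso (l * m) A (\<lambda>e. B (d * m + e))"
proof
  assume "block_iso (l * m) A (\<lambda>e. B (d * m + e))"
  then have "block_iso (Suc z * m) A (\<lambda>e. B (d * m + e))"
    by (rule block_iso_antimono) (use assms in \<open>intro mult_right_mono, auto\<close>)
  moreover have "block_iso (d * m + Suc z * m) A B"
    by (rule block_iso_antimono[OF matched], unfold distrib_right[symmetric],
        rule mult_right_mono) (use assms in auto)
  then have "block_iso (Suc z * m) (\<lambda>e. A (d * m + e)) (\<lambda>e. B (d * m + e))"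
    by (rule block_iso_shift)
  ultimately show False
    using Z block_iso_sym block_iso_trans by blast
qed

text \<open>The known columns \<open>d\<close> to \<open>j - 1\<close> become the first
  \<open>j - d\<close> columns after the shift, and the self-overlap of \<open>A\<close> covers all
  of them, so no text is read again. For \<open>d > j\<close>, which happens after a mismatch in the
  very first column, truncated subtraction makes the block empty.\<close>

lemma shift_matched:
  assumes matched: "block_iso (j * m) A B"
    and Z: "block_iso (z * m) A (\<lambda>e. A (d * m + e))"
    and "j \<le> d + z"
  shows "block_iso ((j - d) * m) A (\<lambda>e. B (d * m + e))"
proof (cases "d \<le> j")
  case True
  then have "block_iso (d * m + (j - d) * m) A B"
    using matched by (simp add: distrib_right[symmetric])
  then have "block_iso ((j - d) * m) (\<lambda>e. A (d * m + e)) (\<lambda>e. B (d * m + e))"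
    by (rule block_iso_shift)
  moreover have "block_iso ((j - d) * m) A (\<lambda>e. A (d * m + e))"
    by (rule block_iso_antimono[OF Z], rule mult_right_mono) (use assms in auto)
  ultimately show ?thesis using block_iso_trans by blast
qed (simp add: block_iso_0)

text \<open>Codes below \<open>m * m\<close> and coordinate pairs correspond through division with
  remainder; \<open>*\<close> states this bijection as an exchange of quantifiers. The quotient is
  the horizontal coordinate, so a prefix of columns is an initial segment of codes.\<close>

lemma order_iso_eq_block_iso:
  assumes "m \<ge> 1"
  shows "order_iso m m S T \<longleftrightarrow>
    block_iso (m * m) (\<lambda>e. T (e div m + 1) (e mod m + 1)) (\<lambda>e. S (e div m + 1) (e mod m + 1))"
proof -
  have *: "(\<forall>e<m*m. F (e div m + 1) (e mod m + 1)) \<longleftrightarrow> (\<forall>x\<in>{1..m}. \<forall>y\<in>{1..m}. F x y)"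
    for F :: "nat \<Rightarrow> nat \<Rightarrow> bool"
  proof safe
    fix x y assume F: "\<forall>e<m*m. F (e div m + 1) (e mod m + 1)" and xy: "x \<in> {1..m}" "y \<in> {1..m}"
    obtain x' y' where "x = Suc x'" "y = Suc y'" using xy by (cases x; cases y) auto
    then have "(x - 1) * m + (y - 1) < Suc (x - 1) * m" using xy by simp
    also have "\<dots> \<le> m * m" using xy by (intro mult_right_mono) auto
    finally have "F (((x - 1) * m + (y - 1)) div m + 1) (((x - 1) * m + (y - 1)) mod m + 1)"
      using F by blast
    moreover have "y - 1 < m" using xy by auto
    then have "((x - 1) * m + (y - 1)) div m = x - 1" "((x - 1) * m + (y - 1)) mod m = y - 1"
      by (simp_all del: add_diff_assoc add_diff_assoc2)
    ultimately show "F x y" using xy by simp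
  next
    fix e assume "e < m * m" and F: "\<forall>x\<in>{1..m}. \<forall>y\<in>{1..m}. F x y"
    then have "e div m < m" "e mod m < m"
      using assms by (auto simp: less_mult_imp_div_less)
    then have "e div m + 1 \<in> {1..m}" "e mod m + 1 \<in> {1..m}"
      by (simp_all add: Suc_le_eq del: mod_less_divisor)
    then show "F (e div m + 1) (e mod m + 1)" using F by blast
  qed
  let ?G = "\<lambda>x y x' y'. S x y \<le> S x' y' \<longleftrightarrow> T x y \<le> T x' y'"
  have swap: "(\<forall>ix\<in>X. \<forall>jx\<in>X. \<forall>iy\<in>X. \<forall>jy\<in>X. H ix iy jx jy) \<longleftrightarrow>
      (\<forall>x\<in>X. \<forall>y\<in>X. \<forall>x'\<in>X. \<forall>y'\<in>X. H x y x' y')"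
    for X :: "nat set" and H :: "nat \<Rightarrow> nat \<Rightarrow> nat \<Rightarrow> nat \<Rightarrow> bool"
    by blast
  have G: "(\<forall>x'\<in>{1..m}. \<forall>y'\<in>{1..m}. ?G x y x' y') \<longleftrightarrow>
      (\<forall>f<m*m. ?G x y (f div m + 1) (f mod m + 1))" for x y
    by (rule *[of "?G x y", symmetric])
  have "order_iso m m S T \<longleftrightarrow>
    (\<forall>x\<in>{1..m}. \<forall>y\<in>{1..m}. \<forall>x'\<in>{1..m}. \<forall>y'\<in>{1..m}. ?G x y x' y')"
    unfolding order_iso_def by (rule swap)
  also have "\<dots> \<longleftrightarrow> (\<forall>x\<in>{1..m}. \<forall>y\<in>{1..m}. \<forall>f<m*m. ?G x y (f div m + 1) (f mod m + 1))"
    by (simp only: G)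
  also have "\<dots> \<longleftrightarrow> (\<forall>e<m*m. \<forall>f<m*m.
      ?G (e div m + 1) (e mod m + 1) (f div m + 1) (f mod m + 1))"
    by (rule *[of "\<lambda>x y. \<forall>f<m*m. ?G x y (f div m + 1) (f mod m + 1)", symmetric])
  also have "\<dots> \<longleftrightarrow>
    block_iso (m * m) (\<lambda>e. S (e div m + 1) (e mod m + 1)) (\<lambda>e. T (e div m + 1) (e mod m + 1))"
    by (simp only: block_iso_def)
  finally show ?thesis using block_iso_sym by blast
qed

section \<open>Sorting the pattern\<close>

text \<open>The pattern entry in column \<open>c\<close> and row \<open>r\<close>, both counted from 0, is coded as \<open>c * m + r\<close>, so that
  blocks of columns are initial segments; the code \<open>m * m\<close> stands for "none". Arrays: \<open>L\<close>, each
  code itself until it is extracted, then "none"; \<open>C\<close>, the least entry of each column still in \<open>L\<close>; \<open>S\<close>,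
  the sorted codes; \<open>P\<close> and \<open>Q\<close>, the lower and upper neighbour of a code among the columns up to its own;
  \<open>Z\<close>, the number of columns on which the pattern shifted by \<open>d\<close> agrees with the pattern.\<close>

abbreviation incr :: "vname \<Rightarrow> com" where
  "incr x \<equiv> Assign x (Bin Add (Var x) (Const 1))"

definition pat_entry :: "aexp \<Rightarrow> entry" where
  "pat_entry e = PatAt (Bin Add (Bin Div e (Var ''m'')) (Const 1))
                       (Bin Add (Bin Mod e (Var ''m'')) (Const 1))"

text \<open>The guards matter for definedness, not only for the result: reading the pattern at the
  code \<open>m * m\<close> has no value, and the short-circuit conjunctions keep both sides of the
  comparison away from it.\<close>

definition minscan_body :: "vname \<Rightarrow> com" where
  "minscan_body a =
     Seq (Assign ''v'' (Elem a (Bin Add (Var ''b'') (Var ''i''))))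
    (Seq (If (And (Less (Var ''v'') (Var ''M''))
                  (Not (And (Less (Var ''w'') (Var ''M''))
                            (EntryLe (pat_entry (Var ''w'')) (pat_entry (Var ''v''))))))
             (Assign ''w'' (Var ''v'')) Skip)
         (incr ''i''))"

text \<open>Serves two arrays: \<open>L\<close> from position \<open>c * m\<close> for the minimum
  of one column, and \<open>C\<close> from position 0 for the minimum of the column minima.\<close>

definition minscan :: "vname \<Rightarrow> com" where
  "minscan a =
     Seq (Assign ''w'' (Var ''M''))
    (Seq (Assign ''i'' (Const 0))
         (While (Less (Var ''i'') (Var ''m'')) (minscan_body a)))"

lemma frame_var: "frame c s s' \<Longrightarrow> x \<notin> written_vars c \<Longrightarrow> vars s' x = vars s x"
  by (simp add: frame_def)

lemma frame_array: "frame c s s' \<Longrightarrow> a \<notin> written_arrays c \<Longrightarrow> arrays s' a = arrays s a"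
  by (simp add: frame_def)

lemma frame_reported: "frame c s s' \<Longrightarrow> silent c \<Longrightarrow> reported s' = reported s"
  by (simp add: frame_def)

lemma writes_minscan:
  "written_vars (minscan_body a) = {''v'', ''w'', ''i''}" "written_arrays (minscan_body a) = {}"
  "silent (minscan_body a)"
  "written_vars (minscan a) = {''v'', ''w'', ''i''}" "written_arrays (minscan a) = {}"
  "silent (minscan a)"
  by (auto simp: minscan_def minscan_body_def)

text \<open>One inequality covers every intermediate value: codes and the sentinel up to
  \<open>m * m\<close>, guards such as \<open>x + m \<le> n + m + 1\<close>, and sums of a shift and
  an overlap. A pattern larger than the text is allowed; the search loop then ends at once.\<close>

locale oppm =
  fixes n m W :: nat and T P :: string2
  assumes n: "1 \<le> n" and m: "1 \<le> m" and bound: "m * m + 2 * n + 3 * m + 10 < W"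
begin

abbreviation inp :: input where
  "inp \<equiv> \<lparr>text_size = n, pat_size = m, text_string = T, pat_string = P\<rparr>"

definition pat :: "nat \<Rightarrow> int" where
  "pat e = P (e div m + 1) (e mod m + 1)"

definition base :: "state \<Rightarrow> bool" where
  "base s \<longleftrightarrow> vars s ''n'' = n \<and> vars s ''m'' = m \<and> vars s ''M'' = m * m"

lemma base_frame:
  "frame c s s' \<Longrightarrow> base s \<Longrightarrow> {''n'', ''m'', ''M''} \<inter> written_vars c = {} \<Longrightarrow> base s'"
  by (auto simp: base_def frame_def)

lemma base_vars: "base s \<Longrightarrow> vars s ''n'' = n" "base s \<Longrightarrow> vars s ''m'' = m" "base s \<Longrightarrow> vars s ''M'' = m * m"
  by (simp_all add: base_def)

lemma index_div_mod:
  assumes "e < m * m"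
  shows "e div m < m" "e mod m < m"
  using assms m by (simp_all add: less_mult_imp_div_less)

lemma small_words: "v \<le> m * m \<Longrightarrow> v < W" "v \<le> n \<Longrightarrow> v < W" "v \<le> m \<Longrightarrow> v < W"
  using bound by auto

lemma pat_entry_val:
  assumes "base s" "aval W e s = Some v" "v < m * m"
  shows "entry_val inp W (pat_entry e) s = Some (pat v)"
proof -
  have "word W (Suc (v div m)) = Some (Suc (v div m))" "word W (Suc (v mod m)) = Some (Suc (v mod m))"
    "word W (v div m) = Some (v div m)" "word W (v mod m) = Some (v mod m)"
    "word W m = Some m" "word W (Suc 0) = Some (Suc 0)"
    by (rule word_ok; use index_div_mod[OF assms(3)] bound in linarith)+
  then show ?thesis
    using assms(1,2) index_div_mod[OF assms(3)]
    by (simp add: pat_entry_def base_def lookup_def pat_def Suc_le_eq del: mod_less_divisor)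
qed

definition is_min :: "nat set \<Rightarrow> nat \<Rightarrow> bool" where
  "is_min X w \<longleftrightarrow> (X = {} \<and> w = m * m) \<or> (w \<in> X \<and> (\<forall>v\<in>X. pat w \<le> pat v))"

lemma is_min_le: "is_min X w \<Longrightarrow> X \<subseteq> {..<m * m} \<Longrightarrow> w \<le> m * m"
  by (auto simp: is_min_def)

lemma is_min_insert:
  assumes "is_min X w" "v < m * m"
  shows "w < m * m \<Longrightarrow> pat w \<le> pat v \<Longrightarrow> is_min (insert v X) w"
    and "w < m * m \<Longrightarrow> \<not> pat w \<le> pat v \<Longrightarrow> is_min (insert v X) v"
    and "\<not> w < m * m \<Longrightarrow> X \<subseteq> {..<m * m} \<Longrightarrow> is_min (insert v X) v"
  using assms by (auto simp: is_min_def)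

lemma wp_minscan:
  assumes base: "base s"
    and b: "vars s ''b'' + m \<le> m * m"
    and le: "\<And>i. i < m \<Longrightarrow> arrays s a (vars s ''b'' + i) \<le> m * m"
    and Q: "\<And>t s'. frame (minscan a) s s' \<Longrightarrow> t \<le> 100 * m \<Longrightarrow>
        is_min {v. v < m * m \<and> (\<exists>i<m. arrays s a (vars s ''b'' + i) = v)} (vars s' ''w'') \<Longrightarrow> Q t s'"
  shows "wp inp W (minscan a) s Q"
proof -
  let ?X = "\<lambda>k. {v. v < m * m \<and> (\<exists>i<k. arrays s a (vars s ''b'' + i) = v)}"
  let ?s = "s\<lparr>vars := (vars s)(''w'' := m * m, ''i'' := 0)\<rparr>"
  have "wp inp W (While (Less (Var ''i'') (Var ''m'')) (minscan_body a)) ?s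
     (\<lambda>t s'. t \<le> 90 * m \<and> is_min (?X m) (vars s' ''w''))"
  proof (rule wp_While[where Inv = "\<lambda>s'. vars s' ''i'' \<le> m \<and> is_min (?X (vars s' ''i'')) (vars s' ''w'')"
        and B = 70 and \<mu> = "\<lambda>s'. m - vars s' ''i''"], goal_cases)
    case 1
    then show ?case by (simp add: is_min_def)
  next
    case (2 s')
    have "base s'" using base_frame[OF 2(1)] base by (simp add: writes_minscan base_def)
    then show ?case using 2 small_words by (simp add: base_def word_ok)
  next
    case (3 s')
    have bs: "base s'" using base_frame[OF 3(1)] base by (simp add: writes_minscan base_def)
    have [simp]: "vars s' ''b'' = vars s ''b''" "arrays s' a = arrays s a"
      using frame_var[OF 3(1)] frame_array[OF 3(1)] by (simp_all add: writes_minscan)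
    let ?i = "vars s' ''i''" and ?w = "vars s' ''w''" and ?v = "arrays s a (vars s ''b'' + vars s' ''i'')"
    have i: "?i < m" using 3(3) bs small_words by (simp add: base_def word_def split: if_splits)
    have w: "?w \<le> m * m" using 3(2) is_min_le[of "?X ?i"] by auto
    have v: "?v \<le> m * m" using le[OF i] .
    have X: "?X (Suc ?i) = (if ?v < m * m then insert ?v (?X ?i) else ?X ?i)"
      by (auto simp: less_Suc_eq)
    have W: "vars s ''b'' + ?i < W" "vars s ''b'' < W" "Suc ?i < W" "?v < W" "?i < W" "?w < W" "m * m < W" "1 < W"
      and less: "m - Suc ?i < m - ?i"
      using i b w v bound by linarith+
    let ?s' = "s'\<lparr>vars := (vars s')(''v'' := ?v)\<rparr>"
    have bs': "base ?s'" using bs by (simp add: base_def)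
    have ev: "?v < m * m \<Longrightarrow> entry_val inp W (pat_entry (Var ''v'')) ?s' = Some (pat ?v)"
      by (rule pat_entry_val[OF bs']) (use W in \<open>simp_all add: word_ok\<close>)
    have ew: "?w < m * m \<Longrightarrow> entry_val inp W (pat_entry (Var ''w'')) ?s' = Some (pat ?w)"
      by (rule pat_entry_val[OF bs']) (use W in \<open>simp_all add: word_ok\<close>)
    have cost: "entry_cost (pat_entry (Var x)) = 11" for x by (simp add: pat_entry_def)
    have min: "is_min (?X ?i) ?w" using 3(2) by simp
    show ?case
      using W less bs i ev ew X is_min_insert[OF min] min
      by (cases "?v < m * m"; cases "?w < m * m")
        (simp_all add: minscan_body_def wp_simps word_ok base_def cost subset_iff)
  next
    case (4 t s')
    have bs: "base s'" using base_frame[OF 4(1)] base by (simp add: writes_minscan base_def)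
    then have "vars s' ''i'' = m" using 4(2,3) small_words by (simp add: base_def word_ok)
    then show ?case using 4 m by simp
  qed
  then have "wp inp W (minscan a) s (\<lambda>t s'. t \<le> 100 * m \<and> is_min (?X m) (vars s' ''w''))"
    unfolding minscan_def using base small_words m
    by (simp add: wp_simps word_ok base_def) (rule wp_mono, assumption, simp)
  then show ?thesis
    by (rule wp_mono) (use Q in blast)
qed

end

section \<open>Selection sort with column minima\<close>

definition refresh_min :: com where
  "refresh_min = Seq (Assign ''b'' (Bin Mul (Var ''c'') (Var ''m'')))
            (Seq (minscan ''L'') (Store ''C'' (Var ''c'') (Var ''w'')))"

definition init_live :: com where
  "init_live = While (Less (Var ''k'') (Var ''M'')) (Seq (Store ''L'' (Var ''k'') (Var ''k'')) (incr ''k''))"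

definition init_columns :: com where
  "init_columns = While (Less (Var ''c'') (Var ''m'')) (Seq refresh_min (incr ''c''))"

definition select_min :: com where
  "select_min =
     Seq (Assign ''b'' (Const 0))
    (Seq (minscan ''C'')
    (Seq (Store ''S'' (Var ''k'') (Var ''w''))
    (Seq (Store ''L'' (Var ''w'') (Var ''M''))
    (Seq (Assign ''c'' (Bin Div (Var ''w'') (Var ''m'')))
    (Seq refresh_min
         (incr ''k''))))))"

definition sort_pattern :: com where
  "sort_pattern =
     Seq (Assign ''M'' (Bin Mul (Var ''m'') (Var ''m'')))
    (Seq (Assign ''k'' (Const 0))
    (Seq init_live
    (Seq (Assign ''c'' (Const 0))
    (Seq init_columns
    (Seq (Assign ''k'' (Const 0))
         (While (Less (Var ''k'') (Var ''M'')) select_min))))))"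

lemma writes_sort:
  "written_vars refresh_min = {''v'', ''w'', ''i'', ''b''}" "written_arrays refresh_min = {''C''}" "silent refresh_min"
  "written_vars select_min = {''v'', ''w'', ''i'', ''b'', ''c'', ''k''}"
  "written_arrays select_min = {''C'', ''S'', ''L''}" "silent select_min"
  "written_vars init_live = {''k''}" "written_arrays init_live = {''L''}" "silent init_live"
  "written_vars init_columns = {''v'', ''w'', ''i'', ''b'', ''c''}"
  "written_arrays init_columns = {''C''}" "silent init_columns"
  "written_vars sort_pattern = {''v'', ''w'', ''i'', ''b'', ''c'', ''k'', ''M''}"
  "written_arrays sort_pattern = {''C'', ''S'', ''L''}" "silent sort_pattern"
  by (auto simp: refresh_min_def select_min_def init_live_def init_columns_def sort_pattern_def writes_minscan)

context oppm
begin

lemma mult_words: "c < m \<Longrightarrow> c * m + m \<le> m * m"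
  using mult_le_mono1[of "Suc c" m m] by simp

definition column :: "nat \<Rightarrow> nat set" where
  "column c = {e. e div m = c}"

lemma column_subset:
  assumes "c < m"
  shows "column c \<subseteq> {..<m * m}"
proof
  fix e assume "e \<in> column c"
  then have "e div m < m" using assms unfolding column_def by blast
  moreover have "0 < m" using m by linarith
  ultimately show "e \<in> {..<m * m}"
    unfolding lessThan_iff by (rule div_less_iff_less_mult[THEN iffD1, rotated])
qed

lemma column_eq: "column c = {c * m + i |i. i < m}"
proof (intro set_eqI iffI)
  fix e assume "e \<in> column c"
  then have "c = e div m" unfolding column_def by blast
  then have "e = c * m + e mod m" by (simp only: div_mult_mod_eq)
  moreover have "e mod m < m" using m by simp
  ultimately show "e \<in> {c * m + i |i. i < m}" by blast
next
  fix e assume "e \<in> {c * m + i |i. i < m}"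
  then obtain i where "e = c * m + i" "i < m" by blast
  then show "e \<in> column c" by (simp add: column_def)
qed

definition live :: "nat set \<Rightarrow> state \<Rightarrow> bool" where
  "live D s \<longleftrightarrow> (\<forall>e<m * m. arrays s ''L'' e = (if e \<in> D then m * m else e))"

lemma live_column:
  assumes "c < m" "live D s"
  shows "{v. v < m * m \<and> (\<exists>i<m. arrays s ''L'' (c * m + i) = v)} = column c - D"
proof -
  have lt: "c * m + i < m * m" if "i < m" for i
    using mult_words[OF assms(1)] that by linarith
  moreover have "arrays s ''L'' (c * m + i) = (if c * m + i \<in> D then m * m else c * m + i)"
    if "i < m" for i
    using assms(2) lt[OF that] unfolding live_def by blast
  ultimately show ?thesis
    unfolding column_eq by (auto split: if_splits)
qed

lemma wp_refresh_min:
  assumes base: "base s" and c: "vars s ''c'' < m" and live: "live D s"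
    and Q: "\<And>t s' w. frame refresh_min s s' \<Longrightarrow> t \<le> 120 * m \<Longrightarrow>
       arrays s' ''C'' = (arrays s ''C'')(vars s ''c'' := w) \<Longrightarrow>
       is_min (column (vars s ''c'') - D) w \<Longrightarrow> Q t s'"
  shows "wp inp W refresh_min s Q"
proof -
  let ?c = "vars s ''c''"
  have words: "?c * m + m \<le> m * m" "?c * m < W" "?c < W" "m < W" "?c < W"
    using mult_words[OF c] bound c by linarith+
  let ?s = "s\<lparr>vars := (vars s)(''b'' := ?c * m)\<rparr>"
  have L: "arrays s ''L'' (?c * m + i) \<le> m * m" if "i < m" for i
    using live that words unfolding live_def by auto
  have "wp inp W refresh_min s (\<lambda>t s'. t \<le> 120 * m \<and>
      (\<exists>w. arrays s' ''C'' = (arrays s ''C'')(?c := w) \<and> is_min (column ?c - D) w))"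
    unfolding refresh_min_def using words base
    apply (simp add: wp_simps word_ok base_def)
    apply (rule wp_minscan)
       apply (simp_all add: base_def L)
    subgoal premises prems for t s'
    proof -
      have [simp]: "vars s' ''c'' = ?c" "arrays s' ''C'' = arrays s ''C''"
        using frame_var[OF prems(6)] frame_array[OF prems(6)] by (simp_all add: writes_minscan)
      have min: "is_min (column ?c - D) (vars s' ''w'')"
        using prems(8) live_column[OF c live] by simp
      have "vars s' ''w'' < W"
        using is_min_le[OF min subset_trans[OF Diff_subset column_subset[OF c]]] bound by linarith
      then show ?thesis using words min prems(7) m by (auto simp: word_ok)
    qed
    done
  then show ?thesis
    by (rule wp_mono) (use Q in blast)
qed

text \<open>Each remaining code is bounded below by the minimum of its own column, and that one by
  \<open>w\<close>. If no column offers a code below \<open>m * m\<close>, then no code remains,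
  which is the sentinel case of \<open>is_min\<close>.\<close>

lemma is_min_columns:
  assumes C: "\<And>c. c < m \<Longrightarrow> is_min (column c - D) (C c)"
    and w: "is_min {v. v < m * m \<and> (\<exists>c<m. C c = v)} w"
  shows "is_min ({..<m * m} - D) w"
proof -
  have *: "C (e div m) < m * m \<and> e div m < m \<and> pat (C (e div m)) \<le> pat e" if "e < m * m" "e \<notin> D" for e
  proof -
    have c: "e div m < m" using that index_div_mod by blast
    have "e \<in> column (e div m) - D" using that by (simp add: column_def)
    with C[OF c] have "C (e div m) \<in> column (e div m)" "pat (C (e div m)) \<le> pat e"
      unfolding is_min_def by blast+
    then show ?thesis using c column_subset[OF c] by auto
  qed
  show ?thesis
  proof (cases "w < m * m")
    case True
    then obtain c where c: "c < m" "C c = w" using w unfolding is_min_def by blast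
    then have "w \<in> column c - D" using C[of c] True unfolding is_min_def by auto
    moreover have "pat w \<le> pat e" if "e < m * m" "e \<notin> D" for e
      using w *[OF that] unfolding is_min_def by (blast intro: order_trans)
    ultimately show ?thesis using True unfolding is_min_def by blast
  next
    case False
    then have "{v. v < m * m \<and> (\<exists>c<m. C c = v)} = {}" "w = m * m"
      using w unfolding is_min_def by auto
    then show ?thesis using * unfolding is_min_def by blast
  qed
qed

text \<open>The last conjunct records every selection at its own time: \<open>S i\<close> was least
  among the codes not extracted before it. Sortedness of the prefix alone would not say that the
  next minimum may be appended.\<close>

definition sort_inv :: "state \<Rightarrow> bool" where
  "sort_inv s \<longleftrightarrow> (let k = vars s ''k''; S = arrays s ''S'' in
     k \<le> m * m \<and> inj_on S {..<k} \<and> S ` {..<k} \<subseteq> {..<m * m} \<and> live (S ` {..<k}) s \<and>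
     (\<forall>c<m. is_min (column c - S ` {..<k}) (arrays s ''C'' c)) \<and>
     (\<forall>i<k. \<forall>e\<in>{..<m * m} - S ` {..<i}. pat (S i) \<le> pat e))"

lemma sort_invI:
  assumes "vars s ''k'' = k" "arrays s ''S'' = S" "k \<le> m * m" "inj_on S {..<k}"
    "S ` {..<k} \<subseteq> {..<m * m}" "live (S ` {..<k}) s"
    "\<And>c. c < m \<Longrightarrow> is_min (column c - S ` {..<k}) (arrays s ''C'' c)"
    "\<And>i e. i < k \<Longrightarrow> e \<in> {..<m * m} - S ` {..<i} \<Longrightarrow> pat (S i) \<le> pat e"
  shows "sort_inv s"
  using assms by (auto simp: sort_inv_def)

lemma wp_select_min:
  assumes base: "base s" and inv: "sort_inv s" and k: "vars s ''k'' < m * m"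
  shows "wp inp W select_min s (\<lambda>t s'. t \<le> 260 * m \<and> vars s' ''k'' = Suc (vars s ''k'') \<and> sort_inv s')"
proof -
  define k' S D where "k' = vars s ''k''" and "S = arrays s ''S''" and "D = S ` {..<k'}"
  have inj: "inj_on S {..<k'}" and D: "D \<subseteq> {..<m * m}" and live: "live D s"
    and C: "\<And>c. c < m \<Longrightarrow> is_min (column c - D) (arrays s ''C'' c)"
    and ord: "\<And>i e. i < k' \<Longrightarrow> e \<in> {..<m * m} - S ` {..<i} \<Longrightarrow> pat (S i) \<le> pat e"
    using inv unfolding sort_inv_def k'_def S_def D_def Let_def by auto
  have Cle: "arrays s ''C'' c \<le> m * m" if "c < m" for c
    using is_min_le[OF C[OF that]] column_subset[OF that] by auto
  \<comment> \<open>By counting: the \<open>k'\<close> extracted codes are distinct and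
    \<open>k' < m * m\<close>. Hence the scan returns a genuine code, not the sentinel, and its
    quotient by \<open>m\<close> is a column.\<close>
  have ne: "{..<m * m} - D \<noteq> {}"
  proof
    assume "{..<m * m} - D = {}"
    then have "card {..<m * m} \<le> card D" by (intro card_mono) (auto simp: D_def)
    also have "card D = k'" using inj by (simp add: D_def card_image)
    finally show False using k by (simp add: k'_def)
  qed
  have words: "k' < W" "Suc k' < W" "m < W" "0 < W" "m * m < W" "1 < W"
    using k bound unfolding k'_def by linarith+
  show ?thesis
    unfolding select_min_def using words base
    apply (simp add: wp_simps word_ok base_def)
    apply (rule wp_minscan)
       apply (simp_all add: base_def Cle)
    subgoal premises prems for t s'
    proof -
      have [simp]: "vars s' ''k'' = k'" "vars s' ''m'' = m" "vars s' ''n'' = n" "vars s' ''M'' = m * m"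
        "arrays s' = arrays s"
        using frame_var[OF prems(5)] frame_array[OF prems(5)] base
        by (simp_all add: writes_minscan base_def k'_def fun_eq_iff)
      let ?w = "vars s' ''w''"
      have min: "is_min ({..<m * m} - D) ?w"
        by (rule is_min_columns[OF C prems(7)[unfolded add_0]])
      then have w: "?w < m * m" "?w \<notin> D" and wmin: "\<And>e. e \<in> {..<m * m} - D \<Longrightarrow> pat ?w \<le> pat e"
        using ne unfolding is_min_def by auto
      have wc: "?w div m < m" using w index_div_mod by blast
      have words': "?w < W" "?w div m < W" using w wc bound by linarith+
      \<comment> \<open>The state between the extraction of \<open>?w\<close> and the repair of its
        column minimum.\<close>
      define s1 where "s1 = s'\<lparr>arrays := (arrays s)(''S'' := S(k' := ?w), ''L'' := (arrays s ''L'')(?w := m * m)),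
           vars := (vars s')(''c'' := ?w div m)\<rparr>"
      have live1: "live (insert ?w D) s1"
        using live by (simp add: live_def s1_def)
      have "wp inp W refresh_min s1 (\<lambda>t2 s2. t2 \<le> 120 * m \<and>
          vars s2 ''k'' = k' \<and> sort_inv (s2\<lparr>vars := (vars s2)(''k'' := Suc k')\<rparr>))"
      proof (rule wp_refresh_min[OF _ _ live1], goal_cases)
        case (3 t2 s2 w2)
        have [simp]: "vars s2 ''k'' = k'" "arrays s2 ''S'' = S(k' := ?w)"
            "arrays s2 ''L'' = (arrays s ''L'')(?w := m * m)"
          using frame_var[OF 3(1)] frame_array[OF 3(1)] by (simp_all add: writes_sort s1_def)
        have img: "S(k' := ?w) ` {..<Suc k'} = insert ?w D"
          by (auto simp: D_def less_Suc_eq image_iff)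
        have img': "S(k' := ?w) ` {..<i} = S ` {..<i}" if "i \<le> k'" for i
          using that by auto
        \<comment> \<open>Only the column of \<open>?w\<close> loses an element, so all other
          entries of \<open>C\<close> stay valid and one refresh suffices.\<close>
        have C2: "is_min (column c - insert ?w D) (arrays s2 ''C'' c)" if "c < m" for c
        proof (cases "c = ?w div m")
          case True
          then show ?thesis using 3 by (simp add: s1_def)
        next
          case False
          then have "column c - insert ?w D = column c - D" by (auto simp: column_def)
          then show ?thesis using 3 C[OF that] False by (simp add: s1_def)
        qed
        have "sort_inv (s2\<lparr>vars := (vars s2)(''k'' := Suc k')\<rparr>)"
        proof -
          let ?S = "S(k' := ?w)"
          have "?w \<notin> ?S ` ({..<k'} - {k'})"
            using w(2) unfolding D_def by (simp add: image_iff)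
          then have "inj_on ?S {..<Suc k'}"
            using inj w(2) unfolding lessThan_Suc inj_on_insert D_def
            by (simp add: inj_on_fun_updI del: fun_upd_image)
          moreover have "live (insert ?w D) (s2\<lparr>vars := (vars s2)(''k'' := Suc k')\<rparr>)"
            using live1 by (simp add: live_def s1_def)
          moreover have "pat (?S i) \<le> pat e" if "i < Suc k'" "e \<in> {..<m * m} - ?S ` {..<i}" for i e
            using that ord[of i e] wmin[of e] img'[of i] by (cases "i = k'") (auto simp: D_def)
          moreover have "Suc k' \<le> m * m" using k by (simp add: k'_def)
          ultimately show ?thesis
            using D w C2 by (intro sort_invI[where k = "Suc k'" and S = ?S]) (simp_all only: img, simp_all)
        qed
        then show ?case using 3 by simp
      qed (use wc base in \<open>simp_all add: s1_def base_def\<close>)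
      then show ?thesis
        using words words' prems(6) m
        apply (simp add: word_ok)
        apply (fold S_def)
        apply (simp add: s1_def)
        apply (erule wp_mono)
        apply (simp add: word_ok k'_def)
        done
    qed
    done
qed

definition sorted_pat :: "state \<Rightarrow> bool" where
  "sorted_pat s \<longleftrightarrow> (let xs = map (arrays s ''S'') [0..<m * m] in
     distinct xs \<and> set xs = {..<m * m} \<and> sorted_wrt (\<lambda>a b. pat a \<le> pat b) xs)"

text \<open>An injection of a finite set into itself is onto, so every code is listed; and for
  \<open>i < j\<close> the code \<open>S j\<close> was still available when \<open>S i\<close> was
  chosen as a minimum.\<close>

lemma sort_inv_sorted:
  assumes inv: "sort_inv s" and k: "vars s ''k'' = m * m"
  shows "sorted_pat s"
proof -
  let ?S = "arrays s ''S''"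
  have S: "inj_on ?S {..<m * m}" "?S ` {..<m * m} \<subseteq> {..<m * m}"
    and ord: "\<And>i e. i < m * m \<Longrightarrow> e \<in> {..<m * m} - ?S ` {..<i} \<Longrightarrow> pat (?S i) \<le> pat e"
    using inv k unfolding sort_inv_def Let_def by auto
  have "?S ` {..<m * m} = {..<m * m}"
    using S by (intro card_subset_eq) (auto simp: card_image)
  moreover have "pat (?S i) \<le> pat (?S j)" if "i < j" "j < m * m" for i j
  proof (rule ord)
    show "?S j \<in> {..<m * m} - ?S ` {..<i}"
      using that S inj_onD[OF S(1)] by fastforce
  qed (use that in simp)
  ultimately show ?thesis
    using S(1) by (simp add: sorted_pat_def distinct_map sorted_wrt_iff_nth_less atLeast0LessThan)
qed

lemma wp_init_live:
  assumes base: "base s" and "vars s ''k'' = 0"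
    and Q: "\<And>t s'. frame init_live s s' \<Longrightarrow> t \<le> 20 * (m * m) \<Longrightarrow> live {} s' \<Longrightarrow> Q t s'"
  shows "wp inp W init_live s Q"
  unfolding init_live_def
proof (rule wp_While[where Inv = "\<lambda>s'. vars s' ''k'' \<le> m * m \<and> (\<forall>e<vars s' ''k''. arrays s' ''L'' e = e)"
        and B = 8 and \<mu> = "\<lambda>s'. m * m - vars s' ''k''"], goal_cases)
  case 1
  then show ?case using assms by simp
next
  case (2 s')
  have "base s'" using base_frame[OF 2(1)] base by (simp add: base_def)
  then show ?case using 2 small_words by (simp add: base_def word_ok)
next
  case (3 s')
  have bs: "base s'" using base_frame[OF 3(1)] base by (simp add: base_def)
  have k: "vars s' ''k'' < m * m" using 3(2,3) bs small_words by (simp add: base_def word_ok)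
  then have "vars s' ''k'' < W" "Suc (vars s' ''k'') < W" "1 < W"
    "m * m - Suc (vars s' ''k'') < m * m - vars s' ''k''"
    using bound by linarith+
  then show ?case using 3(2) k by (simp add: wp_simps word_ok less_Suc_eq)
next
  case (4 t s')
  have bs: "base s'" using base_frame[OF 4(1)] base by (simp add: base_def)
  then have "vars s' ''k'' = m * m" using 4(2,3) small_words by (simp add: base_def word_ok)
  moreover have "1 \<le> m * m" using m by simp
  then have "t \<le> 20 * (m * m)" using 4(4) assms(2) by (simp; linarith)
  ultimately show ?case using 4(1,2) by (intro Q) (simp_all add: frame_While init_live_def live_def)
qed

lemma wp_init_columns:
  assumes base: "base s" and "vars s ''c'' = 0" and live: "live {} s"
    and Q: "\<And>t s'. frame init_columns s s' \<Longrightarrow> t \<le> 140 * (m * m) \<Longrightarrow>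
      (\<forall>c<m. is_min (column c) (arrays s' ''C'' c)) \<Longrightarrow> Q t s'"
  shows "wp inp W init_columns s Q"
  unfolding init_columns_def
proof (rule wp_While[where Inv = "\<lambda>s'. vars s' ''c'' \<le> m \<and>
          (\<forall>c<vars s' ''c''. is_min (column c) (arrays s' ''C'' c))"
        and B = "120 * m + 5" and \<mu> = "\<lambda>s'. m - vars s' ''c''"], goal_cases)
  case 1
  then show ?case using assms by simp
next
  case (2 s')
  have "base s'" using base_frame[OF 2(1)] base by (simp add: base_def writes_sort)
  then show ?case using 2 small_words by (simp add: base_def word_ok)
next
  case (3 s')
  have bs: "base s'" using base_frame[OF 3(1)] base by (simp add: base_def writes_sort)
  have c: "vars s' ''c'' < m" using 3(2,3) bs small_words by (simp add: base_def word_ok)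
  then have words: "vars s' ''c'' < W" "Suc (vars s' ''c'') < W" "1 < W"
    "m - Suc (vars s' ''c'') < m - vars s' ''c''"
    using bound by linarith+
  have live': "live {} s'"
    using live frame_array[OF 3(1), of "''L''"] by (simp add: writes_sort live_def)
  show ?case
    unfolding wp_Seq
  proof (rule wp_refresh_min[OF bs c live'], goal_cases)
    case (1 t s'' w)
    have "vars s'' ''c'' = vars s' ''c''"
      using frame_var[OF 1(1)] by (simp add: writes_sort)
    then show ?case using 1 words c 3(2) by (simp add: wp_simps word_ok less_Suc_eq)
  qed
next
  case (4 t s')
  have bs: "base s'" using base_frame[OF 4(1)] base by (simp add: base_def writes_sort)
  then have "vars s' ''c'' = m" using 4(2,3) small_words by (simp add: base_def word_ok)
  moreover have "1 \<le> m" "m \<le> m * m" using m by simp_all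
  then have "t \<le> 140 * (m * m)" using 4(4) assms(2) by (simp add: algebra_simps; linarith)
  ultimately show ?case using 4(1,2) by (intro Q) (simp_all add: frame_While init_columns_def)
qed

lemma wp_sort_pattern:
  assumes start: "vars s ''n'' = n" "vars s ''m'' = m"
    and Q: "\<And>t s'. frame sort_pattern s s' \<Longrightarrow> t \<le> 500 * (m * m * m) \<Longrightarrow> base s' \<Longrightarrow> sorted_pat s' \<Longrightarrow> Q t s'"
  shows "wp inp W sort_pattern s Q"
proof -
  let ?select_min = "While (Less (Var ''k'') (Var ''M'')) select_min"
  have words: "m < W" "m * m < W" "0 < W" using bound by linarith+
  have sq: "1 \<le> m * m" "m * m \<le> m * m * m" using m by simp_all
  have loop: "wp inp W ?select_min s' (\<lambda>t s'. t \<le> 280 * (m * m * m) \<and> base s' \<and> sorted_pat s')"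
    if bs: "base s'" and inv: "sort_inv s'" and k: "vars s' ''k'' = 0" for s'
  proof (rule wp_While[where Inv = "\<lambda>s. base s \<and> sort_inv s" and B = "260 * m"
        and \<mu> = "\<lambda>s'. m * m - vars s' ''k''"], goal_cases)
    case 1
    then show ?case using that by simp
  next
    case (2 s)
    then have "vars s ''k'' < W" using bound by (simp add: sort_inv_def Let_def)
    then show ?case using 2 words by (simp add: base_def word_ok)
  next
    case (3 s)
    then have "vars s ''k'' < W" using bound by (simp add: sort_inv_def Let_def)
    then have k: "vars s ''k'' < m * m" using 3 words by (simp add: base_def word_ok)
    show ?case
    proof (rule wp_mono[OF wp_select_min])
      fix t s'' assume "frame select_min s s''"
        and "t \<le> 260 * m \<and> vars s'' ''k'' = Suc (vars s ''k'') \<and> sort_inv s''"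
      then show "t \<le> 260 * m \<and> (base s'' \<and> sort_inv s'') \<and>
          m * m - vars s'' ''k'' < m * m - vars s ''k''"
        using base_frame[of select_min s s''] 3(2) k by (simp add: writes_sort)
    qed (use 3 k in auto)
  next
    case (4 t s)
    then have "vars s ''k'' \<le> m * m" "vars s ''k'' < W"
      using bound by (simp_all add: sort_inv_def Let_def)
    then have "vars s ''k'' = m * m" using 4 words by (simp add: base_def word_ok)
    moreover have "t \<le> 280 * (m * m * m)" using 4(4) k sq by (simp add: algebra_simps; linarith)
    ultimately show ?case using 4 sort_inv_sorted by blast
  qed
  have "wp inp W sort_pattern s (\<lambda>t s'. t \<le> 500 * (m * m * m) \<and> base s' \<and> sorted_pat s')"
    unfolding sort_pattern_def using start words
    apply (simp add: wp_simps word_ok)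
    apply (rule wp_init_live)
      apply (simp_all add: base_def)
    subgoal premises prems for t1 s1
    proof -
      have [simp]: "vars s1 ''n'' = n" "vars s1 ''m'' = m" "vars s1 ''M'' = m * m"
        using frame_var[OF prems(5)] start by (simp_all add: writes_sort)
      show ?thesis
      proof (rule wp_init_columns, goal_cases)
        case 3
        then show ?case using prems(7) by (simp add: live_def)
      next
        case (4 t2 s2)
        let ?s = "s2\<lparr>vars := (vars s2)(''k'' := 0)\<rparr>"
        have base2: "base ?s"
          using frame_var[OF 4(1)] by (simp add: writes_sort base_def)
        have "sort_inv ?s"
        proof (rule sort_invI[where k = 0])
          show "live (arrays ?s ''S'' ` {..<0}) ?s"
            using prems(7) frame_array[OF 4(1), of "''L''"] by (simp add: writes_sort live_def)
        qed (use 4(3) in simp_all)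
        from loop[OF base2 this] show ?case
          using words
          by (simp add: wp_simps word_ok)
            (rule wp_mono, assumption, unfold base_def, elim conjE, intro conjI;
             (assumption | use sq prems(6) 4(2) in linarith))
      qed (simp_all add: base_def)
    qed
    done
  then show ?thesis
    by (rule wp_mono) (use Q in blast)
qed

end

section \<open>Neighbours of a column among the preceding columns\<close>

text \<open>The codes below \<open>u\<close> are visited in sorted order, with \<open>l\<close> the
  previous one. The first visited code gets itself as lower neighbour, and each new code gets itself
  as upper neighbour until the next visit overwrites that link. An entry always agrees with itself,
  so the ends need no special treatment later.\<close>

definition link_step :: com where
  "link_step =
     Seq (Assign ''e'' (Elem ''S'' (Var ''k'')))
         (If (Less (Var ''e'') (Var ''u''))
            (Seq (If (Less (Var ''l'') (Var ''M'')) Skip (Assign ''l'' (Var ''e'')))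
            (Seq (If (Less (Var ''e'') (Var ''h'')) Skip
                    (Seq (Store ''P'' (Var ''e'') (Var ''l'')) (Store ''Q'' (Var ''e'') (Var ''e''))))
            (Seq (If (Less (Var ''l'') (Var ''h'')) Skip (Store ''Q'' (Var ''l'') (Var ''e'')))
                 (Assign ''l'' (Var ''e'')))))
            Skip)"

definition link_column :: com where
  "link_column =
     Seq (Assign ''h'' (Bin Mul (Var ''j'') (Var ''m'')))
    (Seq (Assign ''u'' (Bin Add (Var ''h'') (Var ''m'')))
    (Seq (Assign ''l'' (Var ''M''))
    (Seq (Assign ''k'' (Const 0))
         (While (Less (Var ''k'') (Var ''M'')) (Seq link_step (incr ''k''))))))"

definition link_columns :: com where
  "link_columns = Seq (Assign ''j'' (Const 0))
              (While (Less (Var ''j'') (Var ''m'')) (Seq link_column (incr ''j'')))"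

lemma writes_link:
  "written_vars link_step = {''e'', ''l''}" "written_arrays link_step = {''P'', ''Q''}" "silent link_step"
  "written_vars link_column = {''e'', ''l'', ''h'', ''u'', ''k''}"
  "written_arrays link_column = {''P'', ''Q''}" "silent link_column"
  "written_vars link_columns = {''e'', ''l'', ''h'', ''u'', ''k'', ''j''}"
  "written_arrays link_columns = {''P'', ''Q''}" "silent link_columns"
  by (auto simp: link_step_def link_column_def link_columns_def)

text \<open>Appending \<open>e\<close> alters links at \<open>e\<close> and at the old last element
  only; by distinctness no earlier pair of neighbours reads an altered link. For empty
  \<open>ys\<close> the choice \<open>l = e\<close> produces the self-links.\<close>

lemma linked_snoc:
  assumes linked: "linked lo pr su ys" and dist: "distinct (ys @ [e])"
    and l: "l = (if ys = [] then e else last ys)"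
    and pr': "pr' = (if lo \<le> e then pr(e := l) else pr)"
    and su': "su' = (let su1 = if lo \<le> e then su(e := e) else su in if lo \<le> l then su1(l := e) else su1)"
  shows "linked lo pr' su' (ys @ [e])"
proof -
  have "(lo \<le> ys ! i \<longrightarrow> su' (ys ! i) = ys ! Suc i) \<and> (lo \<le> ys ! Suc i \<longrightarrow> pr' (ys ! Suc i) = ys ! i)"
    if i: "Suc i < length ys" for i
  proof -
    have "ys ! i \<noteq> last ys"
      using dist i by (subst last_conv_nth) (auto simp: nth_eq_iff_index_eq)
    moreover have "ys ! i \<noteq> e" "ys ! Suc i \<noteq> e"
      using dist i nth_mem[of i ys] nth_mem[of "Suc i" ys] by auto
    moreover have "(lo \<le> ys ! i \<longrightarrow> su (ys ! i) = ys ! Suc i) \<and>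
        (lo \<le> ys ! Suc i \<longrightarrow> pr (ys ! Suc i) = ys ! i)"
      using linked i unfolding linked_def successively_conv_nth by blast
    moreover have "ys \<noteq> []" using i by auto
    ultimately show ?thesis by (auto simp: pr' su' l Let_def)
  qed
  then have "linked lo pr' su' ys" by (simp add: linked_def successively_conv_nth)
  moreover have "last ys \<noteq> e" if "ys \<noteq> []" using dist that by auto
  ultimately show ?thesis
    by (auto simp: linked_def successively_append_iff pr' su' l Let_def)
qed

context oppm
begin

text \<open>The second conjunct also covers the ends of the list, where \<open>linked\<close> is
  silent. It confines every comparison to the first \<open>Suc j\<close> columns, hence to text that
  may be read.\<close>

definition column_links :: "nat list \<Rightarrow> nat \<Rightarrow> (nat \<Rightarrow> nat) \<Rightarrow> (nat \<Rightarrow> nat) \<Rightarrow> bool" where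
  "column_links xs j pr su \<longleftrightarrow>
     linked (j * m) pr su (filter (\<lambda>e. e < Suc j * m) xs) \<and>
     (\<forall>e\<in>{j * m..<Suc j * m}. pr e < Suc j * m \<and> su e < Suc j * m)"

text \<open>For column \<open>j\<close> only links at codes of that column are ever consulted.
  Therefore a single pair of arrays can hold the links of all columns, and processing a later column
  does not disturb an earlier one.\<close>

lemma column_links_cong:
  assumes "column_links xs j pr su"
    and "\<And>e. e \<in> {j * m..<Suc j * m} \<Longrightarrow> pr' e = pr e \<and> su' e = su e"
  shows "column_links xs j pr' su'"
  using assms unfolding column_links_def linked_def
  by (auto elim!: successively_mono)

definition sorted_list :: "state \<Rightarrow> nat list" where
  "sorted_list s = map (arrays s ''S'') [0..<m * m]"

text \<open>\<open>pr0\<close> and \<open>su0\<close> are the links before the pass; keeping them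
  outside column \<open>j\<close> preserves the columns already done. The value \<open>m * m\<close>
  of \<open>l\<close> means that no code has been visited.\<close>

definition link_inv :: "nat \<Rightarrow> nat list \<Rightarrow> (nat \<Rightarrow> nat) \<Rightarrow> (nat \<Rightarrow> nat) \<Rightarrow> state \<Rightarrow> bool" where
  "link_inv j xs pr0 su0 s \<longleftrightarrow>
     (let k = vars s ''k''; l = vars s ''l''; ys = filter (\<lambda>e. e < Suc j * m) (take k xs);
          pr = arrays s ''P''; su = arrays s ''Q'' in
      k \<le> m * m \<and> linked (j * m) pr su ys \<and>
      (if ys = [] then l = m * m else l = last ys) \<and>
      (\<forall>e\<in>set ys. j * m \<le> e \<longrightarrow> pr e < Suc j * m \<and> su e < Suc j * m) \<and>
      (\<forall>e. e \<notin> {j * m..<Suc j * m} \<longrightarrow> pr e = pr0 e \<and> su e = su0 e))"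

lemma wp_link_step:
  assumes base: "base s" and S: "arrays s ''S'' = S" and xs: "xs = map S [0..<m * m]"
    and dist: "distinct xs" and set: "set xs = {..<m * m}"
    and j: "j < m" and h: "vars s ''h'' = j * m" and u: "vars s ''u'' = Suc j * m"
    and inv: "link_inv j xs pr0 su0 s" and k: "vars s ''k'' < m * m"
  shows "wp inp W (Seq link_step (incr ''k'')) s (\<lambda>t s'. t \<le> 70 \<and>
           vars s' ''k'' = Suc (vars s ''k'') \<and> link_inv j xs pr0 su0 s')"
proof -
  define k' l ys e pr su where "k' = vars s ''k''" and "l = vars s ''l''"
    and "ys = filter (\<lambda>e. e < Suc j * m) (take k' xs)" and "e = S k'"
    and "pr = arrays s ''P''" and "su = arrays s ''Q''"
  have k': "k' < m * m" using k by (simp add: k'_def)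
  have u_le: "Suc j * m \<le> m * m" using j by (intro mult_le_mono1) simp
  have e: "e < m * m" using set k' unfolding xs e_def by auto
  have take: "take (Suc k') xs = take k' xs @ [e]"
    using k' by (simp add: xs e_def take_map take_Suc_conv_app_nth)
  have linked: "linked (j * m) pr su ys"
    and l: "if ys = [] then l = m * m else l = last ys"
    and bd: "\<And>a. a \<in> set ys \<Longrightarrow> j * m \<le> a \<Longrightarrow> pr a < Suc j * m \<and> su a < Suc j * m"
    and rest: "\<And>a. a \<notin> {j * m..<Suc j * m} \<Longrightarrow> pr a = pr0 a \<and> su a = su0 a"
    using inv unfolding link_inv_def Let_def k'_def l_def ys_def pr_def su_def by blast+
  have ys_less: "a < Suc j * m" if "a \<in> set ys" for a using that by (simp add: ys_def)
  have l_less: "l < m * m \<longleftrightarrow> ys \<noteq> []" "l \<le> m * m" "ys \<noteq> [] \<Longrightarrow> l < Suc j * m"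
    using l ys_less[of "last ys"] u_le by (auto split: if_splits)
  have words: "k' < W" "Suc k' < W" "e < W" "l < W" "m * m < W" "j * m < W" "Suc j * m < W" "1 < W"
    using k' e u_le l_less(2) bound by auto
  show ?thesis
  proof (cases "e < Suc j * m")
    case False
    then have "filter (\<lambda>e. e < Suc j * m) (take (Suc k') xs) = ys" by (simp add: take ys_def)
    then have "link_inv j xs pr0 su0 s'"
      if "vars s' ''k'' = Suc k'" "vars s' ''l'' = l" "arrays s' ''P'' = pr" "arrays s' ''Q'' = su" for s'
      unfolding link_inv_def Let_def that using k' linked l bd rest by auto
    then show ?thesis
      unfolding link_step_def using False words base u S
      by (simp add: wp_simps word_ok k'_def[symmetric] e_def[symmetric] l_def pr_def su_def)
  next
    case True
    define l' where "l' = (if ys = [] then e else last ys)"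
    define pr' where "pr' = (if j * m \<le> e then pr(e := l') else pr)"
    define su' where "su' = (let su1 = if j * m \<le> e then su(e := e) else su in
        if j * m \<le> l' then su1(l' := e) else su1)"
    have l': "l' = (if l < m * m then l else e)" "l' < Suc j * m"
      using l l_less True by (auto simp: l'_def)
    have "distinct (take k' xs @ [e])" using dist unfolding take[symmetric] by simp
    then have dist': "distinct (ys @ [e])" by (auto simp: ys_def)
    have linked': "linked (j * m) pr' su' (ys @ [e])"
      by (rule linked_snoc[OF linked dist' l'_def pr'_def su'_def])
    have bd': "pr' a < Suc j * m \<and> su' a < Suc j * m" if "a \<in> set (ys @ [e])" "j * m \<le> a" for a
      using that bd True l'(2) by (auto simp: pr'_def su'_def Let_def)
    have rest': "pr' a = pr0 a \<and> su' a = su0 a" if "a \<notin> {j * m..<Suc j * m}" for a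
      using that rest[OF that] True l'(2) by (auto simp: pr'_def su'_def Let_def)
    have fin: "link_inv j xs pr0 su0 s'"
      if "vars s' ''k'' = Suc k'" "vars s' ''l'' = e" "arrays s' ''P'' = pr'" "arrays s' ''Q'' = su'" for s'
    proof -
      have "filter (\<lambda>e. e < Suc j * m) (take (Suc k') xs) = ys @ [e]"
        using True by (simp add: take ys_def)
      then show ?thesis
        unfolding link_inv_def Let_def that using k' linked' bd' rest' by auto
    qed
    have "l' < W" using l' words by auto
    then show ?thesis
      unfolding link_step_def using True words base h u S
      by (cases "l < m * m"; cases "j * m \<le> e"; cases "j * m \<le> l'")
        (simp_all add: wp_simps word_ok k'_def[symmetric] e_def[symmetric] l_def[symmetric] l'(1)
          pr_def[symmetric] su_def[symmetric] pr'_def su'_def base_vars not_less[symmetric] fin)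
  qed
qed

lemma wp_link_column:
  assumes base: "base s" and sorted: "sorted_pat s" and j: "vars s ''j'' < m"
    and Q: "\<And>t s'. frame link_column s s' \<Longrightarrow> t \<le> 120 * (m * m) \<Longrightarrow>
      column_links (sorted_list s) (vars s ''j'') (arrays s' ''P'') (arrays s' ''Q'') \<Longrightarrow>
      (\<And>e. e \<notin> {vars s ''j'' * m..<Suc (vars s ''j'') * m} \<Longrightarrow>
        arrays s' ''P'' e = arrays s ''P'' e \<and> arrays s' ''Q'' e = arrays s ''Q'' e) \<Longrightarrow> Q t s'"
  shows "wp inp W link_column s Q"
proof -
  define j' xs where "j' = vars s ''j''" and "xs = sorted_list s"
  let ?loop = "While (Less (Var ''k'') (Var ''M'')) (Seq link_step (incr ''k''))"
  let ?s = "s\<lparr>vars := (vars s)(''h'' := j' * m, ''u'' := Suc j' * m, ''l'' := m * m, ''k'' := 0)\<rparr>"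
  let ?pr = "arrays s ''P''" and ?su = "arrays s ''Q''"
  have j': "j' < m" using j by (simp add: j'_def)
  have dist: "distinct xs" and set: "set xs = {..<m * m}"
    using sorted by (simp_all add: sorted_pat_def xs_def sorted_list_def Let_def)
  have len: "length xs = m * m" by (simp add: xs_def sorted_list_def)
  have u_le: "Suc j' * m \<le> m * m" using j' by (intro mult_le_mono1) simp
  have words: "j' < W" "m < W" "j' * m < W" "Suc j' * m < W" "m * m < W" "0 < W"
    using j' u_le bound by auto
  have sq: "1 \<le> m * m" using m by simp
  have loop: "wp inp W ?loop ?s (\<lambda>t s'. t \<le> 100 * (m * m) \<and>
      column_links xs j' (arrays s' ''P'') (arrays s' ''Q'') \<and>
      (\<forall>e. e \<notin> {j' * m..<Suc j' * m} \<longrightarrow> arrays s' ''P'' e = ?pr e \<and> arrays s' ''Q'' e = ?su e))"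
  proof (rule wp_While[where Inv = "link_inv j' xs ?pr ?su" and B = 70
        and \<mu> = "\<lambda>s. m * m - vars s ''k''"], goal_cases)
    case 1
    then show ?case by (simp add: link_inv_def linked_def)
  next
    case (2 s')
    have "base s'" using base_frame[OF 2(1)] base by (simp add: base_def writes_link)
    moreover have "vars s' ''k'' < W" using 2(2) bound by (simp add: link_inv_def Let_def)
    ultimately show ?case using words by (simp add: base_def word_ok)
  next
    case (3 s')
    have bs: "base s'" using base_frame[OF 3(1)] base by (simp add: base_def writes_link)
    have "vars s' ''k'' < W" using 3(2) bound by (simp add: link_inv_def Let_def)
    then have k: "vars s' ''k'' < m * m" using 3(3) bs words by (simp add: base_def word_ok)
    have S: "arrays s' ''S'' = arrays s ''S''" using frame_array[OF 3(1)] by (simp add: writes_link)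
    show ?case
    proof (rule wp_mono[OF wp_link_step[OF bs S _ dist set j' _ _ 3(2) k]], goal_cases)
      case 1
      then show ?case by (simp add: xs_def sorted_list_def)
    next
      case 2
      then show ?case using frame_var[OF 3(1), of "''h''"] by (simp add: writes_link)
    next
      case 3
      then show ?case using frame_var[OF \<open>frame _ ?s s'\<close>, of "''u''"] by (simp add: writes_link)
    next
      case (4 t s'')
      then show ?case using k by auto
    qed
  next
    case (4 t s')
    have bs: "base s'" using base_frame[OF 4(1)] base by (simp add: base_def writes_link)
    have "vars s' ''k'' < W" "vars s' ''k'' \<le> m * m"
      using 4(2) bound by (simp_all add: link_inv_def Let_def)
    then have k: "vars s' ''k'' = m * m" using 4(3) bs words by (simp add: base_def word_ok)
    have "t \<le> 100 * (m * m)" using 4(4) by simp (use sq in linarith)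
    moreover have "take (m * m) xs = xs" by (simp add: len)
    moreover have "e \<in> set (filter (\<lambda>e. e < Suc j' * m) xs)" if "e < Suc j' * m" for e
      unfolding set_filter set using that u_le by auto
    ultimately show ?case
      using 4(2) unfolding link_inv_def Let_def k column_links_def
      by (metis atLeastLessThan_iff)
  qed
  have "wp inp W link_column s (\<lambda>t s'. t \<le> 120 * (m * m) \<and>
      column_links xs j' (arrays s' ''P'') (arrays s' ''Q'') \<and>
      (\<forall>e. e \<notin> {j' * m..<Suc j' * m} \<longrightarrow> arrays s' ''P'' e = ?pr e \<and> arrays s' ''Q'' e = ?su e))"
    unfolding link_column_def using words base_vars[OF base] loop j'_def[symmetric]
    by (simp add: wp_simps word_ok add.commute[of "j' * m" m])
      (erule wp_mono, elim conjE, intro conjI; (assumption | use sq in linarith))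
  then show ?thesis
    by (rule wp_mono) (use Q in \<open>simp add: j'_def xs_def\<close>)
qed

definition links :: "state \<Rightarrow> bool" where
  "links s \<longleftrightarrow> (\<forall>j<m. column_links (sorted_list s) j (arrays s ''P'') (arrays s ''Q''))"

lemma wp_link_columns:
  assumes base: "base s" and sorted: "sorted_pat s"
    and Q: "\<And>t s'. frame link_columns s s' \<Longrightarrow> t \<le> 200 * (m * m * m) \<Longrightarrow> links s' \<Longrightarrow> Q t s'"
  shows "wp inp W link_columns s Q"
proof -
  let ?loop = "While (Less (Var ''j'') (Var ''m'')) (Seq link_column (incr ''j''))"
  let ?s = "s\<lparr>vars := (vars s)(''j'' := 0)\<rparr>"
  have sq: "1 \<le> m * m * m" "m \<le> m * m * m" using m by simp_all
  have words: "0 < W" "m < W" "1 < W" using bound by auto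
  have "wp inp W ?loop ?s (\<lambda>t s'. t \<le> 190 * (m * m * m) \<and> links s')"
  proof (rule wp_While[where Inv = "\<lambda>s'. vars s' ''j'' \<le> m \<and> (\<forall>j<vars s' ''j''.
          column_links (sorted_list s) j (arrays s' ''P'') (arrays s' ''Q''))"
        and B = "120 * (m * m) + 5" and \<mu> = "\<lambda>s. m - vars s ''j''"], goal_cases)
    case 1
    then show ?case by simp
  next
    case (2 s')
    have "base s'" using base_frame[OF 2(1)] base by (simp add: base_def writes_link)
    then show ?case using 2 small_words by (simp add: base_def word_ok)
  next
    case (3 s')
    have bs: "base s'" using base_frame[OF 3(1)] base by (simp add: base_def writes_link)
    have j: "vars s' ''j'' < m" using 3(2,3) bs small_words by (simp add: base_def word_ok)
    have words': "vars s' ''j'' < W" "Suc (vars s' ''j'') < W" using j bound by linarith+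
    have S: "arrays s' ''S'' = arrays s ''S''" using frame_array[OF 3(1)] by (simp add: writes_link)
    then have sorted': "sorted_pat s'" "sorted_list s' = sorted_list s"
      using sorted by (simp_all add: sorted_pat_def sorted_list_def)
    show ?case
      unfolding wp_Seq
    proof (rule wp_link_column[OF bs sorted'(1) j], goal_cases)
      case (1 t s'')
      have j2: "vars s'' ''j'' = vars s' ''j''" using frame_var[OF 1(1)] by (simp add: writes_link)
      have "column_links (sorted_list s) i (arrays s'' ''P'') (arrays s'' ''Q'')"
        if i: "i < Suc (vars s' ''j'')" for i
      proof (cases "i = vars s' ''j''")
        case True
        then show ?thesis using 1(3) sorted'(2) by simp
      next
        case False
        then have "Suc i * m \<le> vars s' ''j'' * m" using i by (intro mult_le_mono1) simp
        show ?thesis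
        proof (rule column_links_cong)
          show "column_links (sorted_list s) i (arrays s' ''P'') (arrays s' ''Q'')"
            using 3(2) i False by simp
          fix e assume "e \<in> {i * m..<Suc i * m}"
          then show "arrays s'' ''P'' e = arrays s' ''P'' e \<and> arrays s'' ''Q'' e = arrays s' ''Q'' e"
            using \<open>Suc i * m \<le> _\<close> unfolding atLeastLessThan_iff
            by (intro 1(4)) (simp only: atLeastLessThan_iff, linarith)
        qed
      qed
      then show ?case using 1(2) j2 words words' j by (simp add: wp_simps word_ok)
    qed
  next
    case (4 t s')
    have bs: "base s'" using base_frame[OF 4(1)] base by (simp add: base_def writes_link)
    have j: "vars s' ''j'' = m" using 4(2,3) bs small_words by (simp add: base_def word_ok)
    have S: "arrays s' ''S'' = arrays s ''S''" using frame_array[OF 4(1)] by (simp add: writes_link)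
    have "t \<le> 190 * (m * m * m)" using 4(4) sq by (simp add: algebra_simps; linarith)
    then show ?case using 4(2) S j by (simp add: links_def sorted_list_def)
  qed
  then have "wp inp W link_columns s (\<lambda>t s'. t \<le> 200 * (m * m * m) \<and> links s')"
    unfolding link_columns_def using words
    by (simp add: wp_simps word_ok) (erule wp_mono, use sq in linarith)
  then show ?thesis
    by (rule wp_mono) (use Q in simp)
qed

end

section \<open>Extending an order-isomorphism by one column\<close>

definition iff_test :: "bexp \<Rightarrow> bexp \<Rightarrow> bexp" where
  "iff_test b1 b2 = And (Not (And b1 (Not b2))) (Not (And b2 (Not b1)))"

definition agree_test :: "(aexp \<Rightarrow> entry) \<Rightarrow> vname \<Rightarrow> vname \<Rightarrow> bexp" where
  "agree_test ent a b =
     And (iff_test (EntryLe (pat_entry (Var a)) (pat_entry (Var b))) (EntryLe (ent (Var a)) (ent (Var b))))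
         (iff_test (EntryLe (pat_entry (Var b)) (pat_entry (Var a))) (EntryLe (ent (Var b)) (ent (Var a))))"

definition column_test_body :: "(aexp \<Rightarrow> entry) \<Rightarrow> com" where
  "column_test_body ent =
     Seq (Assign ''e'' (Bin Add (Var ''h'') (Var ''r'')))
    (Seq (Assign ''p'' (Elem ''P'' (Var ''e'')))
    (Seq (Assign ''q'' (Elem ''Q'' (Var ''e'')))
    (Seq (If (And (agree_test ent ''e'' ''p'') (agree_test ent ''e'' ''q'')) Skip (Assign ''o'' (Const 0)))
         (incr ''r''))))"

text \<open>The parameter \<open>ent\<close> says how the compared string is read, as the shifted
  pattern or as a window of the text. One failed comparison clears \<open>o\<close> for good; an
  early exit would not improve the \<open>O(m)\<close> bound.\<close>

definition column_test :: "(aexp \<Rightarrow> entry) \<Rightarrow> com" where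
  "column_test ent =
     Seq (Assign ''o'' (Const 1))
    (Seq (Assign ''h'' (Bin Mul (Var ''j'') (Var ''m'')))
    (Seq (Assign ''r'' (Const 0))
         (While (Less (Var ''r'') (Var ''m'')) (column_test_body ent))))"

definition shifted_entry :: "aexp \<Rightarrow> entry" where
  "shifted_entry e = PatAt (Bin Add (Var ''d'') (Bin Add (Bin Div e (Var ''m'')) (Const 1)))
                           (Bin Add (Bin Mod e (Var ''m'')) (Const 1))"

definition prefix_step :: com where
  "prefix_step = Seq (column_test shifted_entry) (If (Less (Const 0) (Var ''o'')) (incr ''j'') Skip)"

definition prefix_length :: com where
  "prefix_length =
     Seq (Assign ''j'' (Const 0))
    (Seq (Assign ''o'' (Const 1))
         (While (And (Less (Const 0) (Var ''o'')) (Less (Bin Add (Var ''d'') (Var ''j'')) (Var ''m''))) prefix_step))"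

text \<open>The shift \<open>d = m\<close> is included, where the overlap is necessarily 0: it is
  the shift taken when no smaller one reaches the end of a full match.\<close>

definition prefix_table :: com where
  "prefix_table =
     Seq (Assign ''d'' (Const 0))
         (While (Less (Var ''d'') (Bin Add (Var ''m'') (Const 1)))
            (Seq prefix_length (Seq (Store ''Z'' (Var ''d'') (Var ''j'')) (incr ''d''))))"

lemma writes_column_test:
  "written_vars (column_test_body ent) = {''e'', ''p'', ''q'', ''o'', ''r''}"
  "written_arrays (column_test_body ent) = {}" "silent (column_test_body ent)"
  "written_vars (column_test ent) = {''e'', ''p'', ''q'', ''o'', ''r'', ''h''}"
  "written_arrays (column_test ent) = {}" "silent (column_test ent)"
  by (auto simp: column_test_body_def column_test_def)

lemma writes_prefix:
  "written_vars prefix_step = {''e'', ''p'', ''q'', ''o'', ''r'', ''h'', ''j''}"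
  "written_arrays prefix_step = {}" "silent prefix_step"
  "written_vars prefix_length = {''e'', ''p'', ''q'', ''o'', ''r'', ''h'', ''j''}"
  "written_arrays prefix_length = {}" "silent prefix_length"
  "written_vars prefix_table = {''e'', ''p'', ''q'', ''o'', ''r'', ''h'', ''j'', ''d''}"
  "written_arrays prefix_table = {''Z''}" "silent prefix_table"
  by (auto simp: prefix_step_def prefix_length_def prefix_table_def writes_column_test)

lemma bval_iff_test:
  "bval I W b1 s = Some u \<Longrightarrow> bval I W b2 s = Some v \<Longrightarrow> bval I W (iff_test b1 b2) s = Some (u = v)"
  by (cases u; cases v) (simp_all add: iff_test_def)

context oppm
begin

section \<open>Correctness of the column test\<close>

text \<open>Sufficiency is \<open>block_iso_extend\<close>; necessity holds because the links never
  leave the first \<open>Suc j\<close> columns. Both are wanted: skipping positions is justified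
  only if a failed test is a genuine mismatch.\<close>

lemma column_links_extend:
  assumes sorted: "sorted_pat s" and links: "links s" and j: "j < m"
    and iso: "block_iso (j * m) pat B"
  shows "(\<forall>e\<in>{j * m..<Suc j * m}. agree pat B e (arrays s ''P'' e) \<and> agree pat B e (arrays s ''Q'' e)) \<longleftrightarrow>
    block_iso (Suc j * m) pat B" (is "?L \<longleftrightarrow> ?R")
proof
  let ?xs = "filter (\<lambda>e. e < Suc j * m) (sorted_list s)"
  have col: "linked (j * m) (arrays s ''P'') (arrays s ''Q'') ?xs"
    and less: "\<And>e. e \<in> {j * m..<Suc j * m} \<Longrightarrow> arrays s ''P'' e < Suc j * m \<and> arrays s ''Q'' e < Suc j * m"
    using links j unfolding links_def column_links_def by blast+
  have u: "Suc j * m \<le> m * m" using j by (intro mult_le_mono1) simp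
  have "set (sorted_list s) = {..<m * m}"
    using sorted unfolding sorted_pat_def Let_def sorted_list_def by blast
  then have set: "set ?xs = {..<Suc j * m}"
    unfolding set_filter using order_less_le_trans[OF _ u] by blast
  have ord: "sorted_wrt (\<lambda>a b. pat a \<le> pat b) ?xs"
    using sorted unfolding sorted_pat_def Let_def sorted_list_def[symmetric]
    by (intro sorted_wrt_filter) blast
  show ?R if ?L
    by (rule block_iso_extend[OF iso set ord col]) (use that in simp)
  show ?L if ?R
  proof
    fix e assume e: "e \<in> {j * m..<Suc j * m}"
    then show "agree pat B e (arrays s ''P'' e) \<and> agree pat B e (arrays s ''Q'' e)"
      using block_iso_agree[OF \<open>?R\<close>, of e] less[OF e] by simp
  qed
qed

lemma bval_agree_test:
  assumes base: "base s" and a: "vars s a < m * m" and b: "vars s b < m * m"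
    and "entry_val inp W (ent (Var a)) s = Some (B (vars s a))"
    and "entry_val inp W (ent (Var b)) s = Some (B (vars s b))"
  shows "bval inp W (agree_test ent a b) s = Some (agree pat B (vars s a) (vars s b))"
proof -
  have "entry_val inp W (pat_entry (Var c)) s = Some (pat (vars s c))" if "c \<in> {a, b}" for c
    by (rule pat_entry_val[OF base]) (use that a b bound in \<open>auto simp: word_ok\<close>)
  then have
    "bval inp W (EntryLe (pat_entry (Var c)) (pat_entry (Var d))) s = Some (pat (vars s c) \<le> pat (vars s d))"
    "bval inp W (EntryLe (ent (Var c)) (ent (Var d))) s = Some (B (vars s c) \<le> B (vars s d))"
    if "c \<in> {a, b}" "d \<in> {a, b}" for c d
    using that assms(4,5) by auto
  then have
    "bval inp W (iff_test (EntryLe (pat_entry (Var c)) (pat_entry (Var d)))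
       (EntryLe (ent (Var c)) (ent (Var d)))) s =
     Some ((pat (vars s c) \<le> pat (vars s d)) = (B (vars s c) \<le> B (vars s d)))"
    if "c \<in> {a, b}" "d \<in> {a, b}" for c d
    using that by (intro bval_iff_test)
  then show ?thesis
    by (auto simp: agree_test_def agree_def split: bool.split)
qed

text \<open>13 is the cost of \<open>shifted_entry\<close>, the dearer of the two ways of reading;
  for that cost 215 is the exact value.\<close>

lemma bcost_agree_test:
  assumes "\<And>x. entry_cost (ent (Var x)) \<le> 13"
  shows "bcost (agree_test ent a b) \<le> 215"
  using assms[of a] assms[of b] by (simp add: agree_test_def iff_test_def pat_entry_def)

text \<open>The reading hypothesis ranges over all states in the frame because entries are read
  while the test is running. It is restricted to codes below \<open>Suc j * m\<close>, so that only
  matched columns and the next one have to be readable.\<close>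

lemma wp_column_test:
  assumes base: "base s" and sorted: "sorted_pat s" and links: "links s"
    and j: "vars s ''j'' < m"
    and cost: "\<And>x. entry_cost (ent (Var x)) \<le> 13"
    and ent: "\<And>s' x. frame (column_test ent) s s' \<Longrightarrow> vars s' x < Suc (vars s ''j'') * m \<Longrightarrow>
      entry_val inp W (ent (Var x)) s' = Some (B (vars s' x))"
    and iso: "block_iso (vars s ''j'' * m) pat B"
    and Q: "\<And>t s'. frame (column_test ent) s s' \<Longrightarrow> t \<le> 600 * m \<Longrightarrow>
      vars s' ''o'' = (if block_iso (Suc (vars s ''j'') * m) pat B then 1 else 0) \<Longrightarrow> Q t s'"
  shows "wp inp W (column_test ent) s Q"
proof -
  define j' pr su where "j' = vars s ''j''" and "pr = arrays s ''P''" and "su = arrays s ''Q''"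
  let ?loop = "While (Less (Var ''r'') (Var ''m'')) (column_test_body ent)"
  let ?s = "s\<lparr>vars := (vars s)(''o'' := 1, ''h'' := j' * m, ''r'' := 0)\<rparr>"
  let ?ok = "\<lambda>e. agree pat B e (pr e) \<and> agree pat B e (su e)"
  have j': "j' < m" using j by (simp add: j'_def)
  have u_le: "Suc j' * m \<le> m * m" using j' by (intro mult_le_mono1) simp
  have less: "pr e < Suc j' * m \<and> su e < Suc j' * m" if "e \<in> {j' * m..<Suc j' * m}" for e
    using links j' that unfolding links_def column_links_def pr_def su_def by blast
  have words: "j' < W" "m < W" "j' * m < W" "0 < W" "1 < W"
    using j' u_le bound by auto
  have test_cost: "bcost (agree_test ent a b) \<le> 215" for a b
    by (rule bcost_agree_test) (rule cost)
  have loop: "wp inp W ?loop ?s (\<lambda>t s'. t \<le> 550 * m \<and>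
      vars s' ''o'' = (if \<forall>e\<in>{j' * m..<Suc j' * m}. ?ok e then 1 else 0))"
  proof (rule wp_While[where Inv = "\<lambda>s'. vars s' ''r'' \<le> m \<and>
        vars s' ''o'' = (if \<forall>e\<in>{j' * m..<j' * m + vars s' ''r''}. ?ok e then 1 else 0)"
        and B = 460 and \<mu> = "\<lambda>s'. m - vars s' ''r''"], goal_cases)
    case 1
    then show ?case by simp
  next
    case (2 s')
    have "base s'" using base_frame[OF 2(1)] base by (simp add: base_def writes_column_test)
    then show ?case using 2 small_words by (simp add: base_def word_ok)
  next
    case (3 s')
    have bs: "base s'" using base_frame[OF 3(1)] base by (simp add: base_def writes_column_test)
    have fr [simp]: "vars s' ''h'' = j' * m" "arrays s' = arrays s" "vars s' ''j'' = j'"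
      using frame_var[OF 3(1)] frame_array[OF 3(1)] by (auto simp: writes_column_test j'_def)
    define r where "r = vars s' ''r''"
    have r: "r < m" using 3(2,3) bs small_words by (simp add: base_def word_ok r_def)
    define e where "e = j' * m + r"
    have e: "e \<in> {j' * m..<Suc j' * m}" "e < m * m" using r u_le by (auto simp: e_def)
    have pq: "pr e < Suc j' * m" "su e < Suc j' * m" using less[OF e(1)] by auto
    have words': "r < W" "Suc r < W" "e < W" "pr e < W" "su e < W"
      using r e pq u_le bound by linarith+
    let ?s1 = "s'\<lparr>vars := (vars s')(''e'' := e, ''p'' := pr e, ''q'' := su e)\<rparr>"
    have bs1: "base ?s1" using bs by (simp add: base_def)
    have "frame (column_test ent) s s'"
      using 3(1) unfolding frame_While frame_def by (auto simp: writes_column_test)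
    then have frame1: "frame (column_test ent) s ?s1"
      by (auto simp: frame_def writes_column_test)
    have ent1: "entry_val inp W (ent (Var x)) ?s1 = Some (B (vars ?s1 x))" if "x \<in> {''e'', ''p'', ''q''}" for x
      using that e(1) pq by (intro ent[OF frame1]) (auto simp: j'_def)
    have test: "bval inp W (agree_test ent ''e'' x) ?s1 = Some (agree pat B e (vars ?s1 x))"
      if x: "x \<in> {''p'', ''q''}" for x
    proof -
      have "vars ?s1 x < m * m" using x pq u_le by auto
      then show ?thesis
        using bval_agree_test[OF bs1, of "''e''" x ent B] ent1[of "''e''"] ent1[of x] x e(2) by simp
    qed
    have "(\<forall>a\<in>{j' * m..<j' * m + Suc r}. ?ok a) \<longleftrightarrow> (\<forall>a\<in>{j' * m..<j' * m + r}. ?ok a) \<and> ?ok e"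
      by (auto simp: e_def less_Suc_eq)
    moreover have "bcost (agree_test ent ''e'' ''p'') + bcost (agree_test ent ''e'' ''q'') \<le> 430"
      using test_cost[of "''e''" "''p''"] test_cost[of "''e''" "''q''"] by simp
    moreover have "m - Suc r < m - r" using r by simp
    ultimately show ?case
      unfolding column_test_body_def
      using words words' test[of "''p''"] test[of "''q''"] 3(2) r
      by (cases "agree pat B e (pr e)"; cases "agree pat B e (su e)")
        (simp_all add: wp_simps word_ok r_def[symmetric] e_def[symmetric] pr_def[symmetric] su_def[symmetric])
  next
    case (4 t s')
    have bs: "base s'" using base_frame[OF 4(1)] base by (simp add: base_def writes_column_test)
    have r: "vars s' ''r'' = m" using 4(2,3) bs small_words by (simp add: base_def word_ok)
    have "t \<le> 550 * m" using 4(4) m by simp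
    then show ?case using 4(2) r by (simp add: add.commute)
  qed
  have ok: "(\<forall>e\<in>{j' * m..<Suc j' * m}. ?ok e) \<longleftrightarrow> block_iso (Suc j' * m) pat B"
    unfolding pr_def su_def using column_links_extend[OF sorted links j'] iso by (simp add: j'_def)
  have "wp inp W (column_test ent) s (\<lambda>t s'. t \<le> 600 * m \<and>
      vars s' ''o'' = (if block_iso (Suc j' * m) pat B then 1 else 0))"
    using loop words m base_vars[OF base] unfolding ok column_test_def
    by (simp add: wp_simps word_ok j'_def[symmetric]) (intro conjI impI; erule wp_mono; simp)
  then show ?thesis
    by (rule wp_mono) (use Q in \<open>simp add: j'_def\<close>)
qed

definition ready :: "state \<Rightarrow> bool" where
  "ready s \<longleftrightarrow> base s \<and> sorted_pat s \<and> links s"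

lemma ready_frame:
  assumes "frame c s s'" "ready s" "{''n'', ''m'', ''M''} \<inter> written_vars c = {}"
    "{''S'', ''P'', ''Q''} \<inter> written_arrays c = {}"
  shows "ready s'"
proof -
  have "arrays s' a = arrays s a" if "a \<in> {''S'', ''P'', ''Q''}" for a
    using frame_array[OF assms(1)] assms(4) that by blast
  then show ?thesis
    using base_frame[OF assms(1) _ assms(3)] assms(2)
    by (simp add: ready_def sorted_pat_def links_def sorted_list_def)
qed

lemma ready_base: "ready s \<Longrightarrow> base s"
  by (simp add: ready_def)

section \<open>Self-overlaps of the pattern\<close>

definition shifted :: "nat \<Rightarrow> nat \<Rightarrow> int" where
  "shifted d e = pat (d * m + e)"

lemma shifted_eq: "shifted d e = P (d + e div m + 1) (e mod m + 1)"
  using m by (simp add: shifted_def pat_def)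

lemma shifted_entry_val:
  assumes base: "base s" and "vars s ''d'' + j < m" and x: "vars s x < Suc j * m"
  shows "entry_val inp W (shifted_entry (Var x)) s = Some (shifted (vars s ''d'') (vars s x))"
proof -
  let ?d = "vars s ''d''" and ?e = "vars s x"
  have "?e div m < Suc j" using x by (simp only: less_mult_imp_div_less)
  then have col: "?d + ?e div m < m" using assms(2) by linarith
  have row: "?e mod m < m" using m by simp
  have "Suc j * m \<le> m * m" using assms(2) by (intro mult_le_mono1) simp
  then have e: "?e < m * m" using x by linarith
  have "word W (Suc (?e div m)) = Some (Suc (?e div m))" "word W (Suc (?e mod m)) = Some (Suc (?e mod m))"
    "word W (Suc (?d + ?e div m)) = Some (Suc (?d + ?e div m))"
    "word W (?e div m) = Some (?e div m)" "word W (?e mod m) = Some (?e mod m)"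
    "word W m = Some m" "word W (Suc 0) = Some (Suc 0)" "word W ?d = Some ?d" "word W ?e = Some ?e"
    by (rule word_ok; use col row e bound in linarith)+
  then show ?thesis
    using base_vars[OF base] col row
    by (simp add: shifted_entry_def lookup_def shifted_eq Suc_le_eq del: mod_less_divisor)
qed

text \<open>The Z-array of the pattern as a string of columns, with order-isomorphism in place of
  equality. Failure on \<open>Suc z\<close> columns excludes all longer overlaps by
  \<open>block_iso_antimono\<close>; it is claimed only while column \<open>d + z\<close>
  exists.\<close>

definition prefix_at :: "nat \<Rightarrow> nat \<Rightarrow> bool" where
  "prefix_at d z \<longleftrightarrow> d + z \<le> m \<and> block_iso (z * m) pat (shifted d) \<and>
     (d + z < m \<longrightarrow> \<not> block_iso (Suc z * m) pat (shifted d))"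

lemma wp_prefix_length:
  assumes ready: "ready s" and d: "vars s ''d'' \<le> m"
    and Q: "\<And>t s'. frame prefix_length s s' \<Longrightarrow> t \<le> 1400 * (m * m) \<Longrightarrow>
      prefix_at (vars s ''d'') (vars s' ''j'') \<Longrightarrow> Q t s'"
  shows "wp inp W prefix_length s Q"
proof -
  define d' where "d' = vars s ''d''"
  have d': "d' \<le> m" using d by (simp add: d'_def)
  let ?b = "And (Less (Const 0) (Var ''o'')) (Less (Bin Add (Var ''d'') (Var ''j'')) (Var ''m''))"
  let ?s = "s\<lparr>vars := (vars s)(''j'' := 0, ''o'' := 1)\<rparr>"
  have words: "0 < W" "1 < W" "m < W" "d' < W" using bound d' by auto
  have sq: "1 \<le> m * m" "m \<le> m * m" using m by simp_all
  have guard: "bval inp W ?b s' = Some (0 < vars s' ''o'' \<and> d' + vars s' ''j'' < m)"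
    if "frame (While ?b prefix_step) ?s s'" "vars s' ''o'' \<le> 1" "d' + vars s' ''j'' \<le> m" for s'
  proof -
    have "base s'" using base_frame[OF that(1)] ready_base[OF ready] by (simp add: base_def writes_prefix)
    moreover have "vars s' ''d'' = d'"
      using frame_var[OF that(1), of "''d''"] by (simp add: writes_prefix d'_def)
    moreover have "vars s' ''o'' < W" "vars s' ''j'' < W" "d' + vars s' ''j'' < W"
      using that(2,3) bound by linarith+
    ultimately show ?thesis using words by (simp add: word_ok base_vars split: bool.split)
  qed
  have "wp inp W (While ?b prefix_step) ?s (\<lambda>t s'. t \<le> 1300 * (m * m) \<and> prefix_at d' (vars s' ''j''))"
  \<comment> \<open>The summand for \<open>o\<close> pays for the one failing test: a round either
    advances \<open>j\<close> with \<open>o\<close> still 1, or leaves \<open>j\<close> and drops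
    \<open>o\<close> to 0.\<close>
  proof (rule wp_While[where B = "600 * m + 9" and \<mu> = "\<lambda>s'. m - vars s' ''j'' + vars s' ''o''"
        and Inv = "\<lambda>s'. vars s' ''o'' \<le> 1 \<and> d' + vars s' ''j'' \<le> m \<and>
          block_iso (vars s' ''j'' * m) pat (shifted d') \<and>
          (vars s' ''o'' = 0 \<longrightarrow> \<not> block_iso (Suc (vars s' ''j'') * m) pat (shifted d'))"], goal_cases)
    case 1
    then show ?case using d' by (simp add: block_iso_0)
  next
    case (2 s')
    then show ?case using guard[of s'] unfolding frame_While by simp
  next
    case (3 s')
    have o: "vars s' ''o'' = 1" and j: "d' + vars s' ''j'' < m"
      using 3 guard[of s'] unfolding frame_While by auto
    have ready': "ready s'"
      using ready_frame[OF 3(1)] ready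
      by (simp add: writes_prefix ready_def base_def sorted_pat_def links_def sorted_list_def)
    have d1: "vars s' ''d'' = d'"
      using frame_var[OF 3(1), of "''d''"] by (simp add: writes_prefix d'_def)
    show ?case
      unfolding prefix_step_def wp_Seq
    proof (rule wp_column_test[where B = "shifted d'"], goal_cases)
      case (6 s2 x)
      have "base s2" using base_frame[OF 6(1)] ready_base[OF ready'] by (simp add: writes_column_test)
      moreover have "vars s2 ''d'' = d'" using frame_var[OF 6(1)] d1 by (simp add: writes_column_test)
      ultimately show ?case using shifted_entry_val[of s2 "vars s' ''j''" x] j 6(2) by simp
    next
      case (8 t s2)
      have j2: "vars s2 ''j'' = vars s' ''j''" using frame_var[OF 8(1)] by (simp add: writes_column_test)
      have words': "vars s' ''j'' < W" "Suc (vars s' ''j'') < W" "m - Suc (vars s' ''j'') < m - vars s' ''j''"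
        using j bound by linarith+
      show ?case
        using 8(2,3) j2 o j words words' 3(2)
        by (cases "block_iso (Suc (vars s' ''j'') * m) pat (shifted d')") (simp_all add: wp_simps word_ok)
    qed (use ready' 3(2) j in \<open>simp_all add: ready_def shifted_entry_def\<close>)
  next
    case (4 t s')
    have "\<not> (0 < vars s' ''o'' \<and> d' + vars s' ''j'' < m)"
      using 4 guard[of s'] unfolding frame_While by auto
    then have "prefix_at d' (vars s' ''j'')" using 4(2) by (auto simp: prefix_at_def)
    moreover have "t \<le> 1300 * (m * m)" using 4(4) sq by (simp add: algebra_simps; linarith)
    ultimately show ?case by simp
  qed
  then have "wp inp W prefix_length s (\<lambda>t s'. t \<le> 1400 * (m * m) \<and> prefix_at d' (vars s' ''j''))"
    unfolding prefix_length_def using words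
    by (simp add: wp_simps word_ok) (erule wp_mono, elim conjE, intro conjI; (assumption | use sq in linarith))
  then show ?thesis
    by (rule wp_mono) (use Q in \<open>simp add: d'_def\<close>)
qed

lemma wp_prefix_table:
  assumes ready: "ready s"
    and Q: "\<And>t s'. frame prefix_table s s' \<Longrightarrow> t \<le> 3000 * (m * m * m) \<Longrightarrow>
      (\<And>d. d \<le> m \<Longrightarrow> prefix_at d (arrays s' ''Z'' d)) \<Longrightarrow> Q t s'"
  shows "wp inp W prefix_table s Q"
proof -
  let ?body = "Seq prefix_length (Seq (Store ''Z'' (Var ''d'') (Var ''j'')) (incr ''d''))"
  let ?loop = "While (Less (Var ''d'') (Bin Add (Var ''m'') (Const 1))) ?body"
  let ?s = "s\<lparr>vars := (vars s)(''d'' := 0)\<rparr>"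
  have words: "0 < W" "1 < W" "m < W" "Suc m < W" using bound by auto
  have sq: "1 \<le> m * m * m" "m \<le> m * m * m" "m * m \<le> m * m * m" using m by simp_all
  have guard: "bval inp W (Less (Var ''d'') (Bin Add (Var ''m'') (Const 1))) s' = Some (vars s' ''d'' < Suc m)"
    if "frame ?loop ?s s'" "vars s' ''d'' \<le> Suc m" for s'
  proof -
    have "base s'" using base_frame[OF that(1)] ready_base[OF ready] by (simp add: base_def writes_prefix)
    then show ?thesis using that(2) words by (simp add: word_ok base_vars)
  qed
  have "wp inp W ?loop ?s (\<lambda>t s'. t \<le> 2900 * (m * m * m) \<and> (\<forall>d\<le>m. prefix_at d (arrays s' ''Z'' d)))"
  proof (rule wp_While[where B = "1400 * (m * m) + 10" and \<mu> = "\<lambda>s'. Suc m - vars s' ''d''"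
        and Inv = "\<lambda>s'. vars s' ''d'' \<le> Suc m \<and> (\<forall>d<vars s' ''d''. prefix_at d (arrays s' ''Z'' d))"],
      goal_cases)
    case 1
    then show ?case by simp
  next
    case (2 s')
    then show ?case using guard[of s'] unfolding frame_While by simp
  next
    case (3 s')
    have d: "vars s' ''d'' \<le> m" using 3 guard[of s'] unfolding frame_While by auto
    have ready': "ready s'"
      using ready_frame[OF 3(1)] ready
      by (simp add: writes_prefix ready_def base_def sorted_pat_def links_def sorted_list_def)
    show ?case
      unfolding wp_Seq
    proof (rule wp_prefix_length[OF ready' d], goal_cases)
      case (1 t s2)
      have fr: "vars s2 ''d'' = vars s' ''d''" "arrays s2 = arrays s'"
        using frame_var[OF 1(1)] frame_array[OF 1(1)] by (auto simp: writes_prefix)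
      have "vars s2 ''j'' \<le> m" using 1(3) by (simp add: prefix_at_def)
      then have words': "vars s2 ''j'' < W" "vars s' ''d'' < W" "Suc (vars s' ''d'') < W"
        "m - vars s' ''d'' < Suc m - vars s' ''d''"
        using d bound by linarith+
      show ?case
        using 1(2,3) fr words words' 3(2) d by (simp add: wp_simps word_ok less_Suc_eq)
    qed
  next
    case (4 t s')
    have "vars s' ''d'' = Suc m" using 4 guard[of s'] unfolding frame_While by auto
    moreover have "t \<le> 2900 * (m * m * m)" using 4(4) sq by (simp add: algebra_simps; linarith)
    ultimately show ?case using 4(2) by (simp add: less_Suc_eq_le)
  qed
  then have "wp inp W prefix_table s (\<lambda>t s'. t \<le> 3000 * (m * m * m) \<and>
      (\<forall>d\<le>m. prefix_at d (arrays s' ''Z'' d)))"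
    unfolding prefix_table_def using words
    by (simp add: wp_simps word_ok) (erule wp_mono, elim conjE, intro conjI; (assumption | use sq in linarith))
  then show ?thesis
    by (rule wp_mono) (use Q in simp)
qed

end

section \<open>Searching the text\<close>

definition text_entry :: "aexp \<Rightarrow> entry" where
  "text_entry e = TextAt (Bin Add (Var ''x'') (Bin Div e (Var ''m'')))
                         (Bin Add (Var ''y'') (Bin Mod e (Var ''m'')))"

text \<open>Stops at the least positive shift whose overlap covers the rest of the matched part; in
  Knuth-Morris-Pratt a precomputed border provides it.\<close>

definition shift_scan :: com where
  "shift_scan =
     Seq (Assign ''d'' (Const 1))
         (While (Less (Bin Add (Var ''d'') (Elem ''Z'' (Var ''d''))) (Var ''j'')) (incr ''d''))"

text \<open>Presetting \<open>o\<close> to 0 lets a full match share the branch of a mismatch: for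
  \<open>j = m\<close> no test is made, the position is reported, and the same shift
  follows.\<close>

definition search_step :: com where
  "search_step =
     Seq (Assign ''o'' (Const 0))
    (Seq (If (Less (Var ''j'') (Var ''m'')) (column_test text_entry) Skip)
         (If (Less (Const 0) (Var ''o'')) (incr ''j'')
            (Seq (If (Less (Var ''j'') (Var ''m'')) Skip (Report (Var ''x'') (Var ''y'')))
            (Seq shift_scan
            (Seq (Assign ''x'' (Bin Add (Var ''x'') (Var ''d'')))
                 (Assign ''j'' (Bin Sub (Var ''j'') (Var ''d''))))))))"

definition search_strip :: com where
  "search_strip =
     Seq (Assign ''x'' (Const 1))
    (Seq (Assign ''j'' (Const 0))
         (While (Less (Bin Add (Var ''x'') (Var ''m'')) (Bin Add (Var ''n'') (Const 2))) search_step))"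

definition search :: com where
  "search =
     Seq (Assign ''y'' (Const 1))
         (While (Less (Bin Add (Var ''y'') (Var ''m'')) (Bin Add (Var ''n'') (Const 2)))
            (Seq search_strip (incr ''y'')))"

definition oppm_program :: com where
  "oppm_program = Seq sort_pattern (Seq link_columns (Seq prefix_table search))"

text \<open>These instances apply only behind a leading conditional or assignment. Rewriting thus
  halts before the shift, whose specification is then used as a whole.\<close>

lemmas wp_Seq_If = wp_Seq[where ?c1.0 = "com.If b c c'" for b c c']
lemmas wp_Seq_Assign = wp_Seq[where ?c1.0 = "Assign x e" for x e]

lemma writes_search:
  "written_vars shift_scan = {''d''}" "written_arrays shift_scan = {}" "silent shift_scan"
  "written_vars search_step = {''e'', ''p'', ''q'', ''o'', ''r'', ''h'', ''j'', ''d'', ''x''}"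
  "written_arrays search_step = {}"
  "written_vars search_strip = {''e'', ''p'', ''q'', ''o'', ''r'', ''h'', ''j'', ''d'', ''x''}"
  "written_arrays search_strip = {}"
  "written_vars search = {''e'', ''p'', ''q'', ''o'', ''r'', ''h'', ''j'', ''d'', ''x'', ''y''}"
  "written_arrays search = {}"
  by (auto simp: shift_scan_def search_step_def search_strip_def search_def writes_column_test)

context oppm
begin

definition window :: "nat \<Rightarrow> nat \<Rightarrow> nat \<Rightarrow> int" where
  "window x y e = T (x + e div m) (y + e mod m)"

text \<open>Column-major codes make a horizontal move by \<open>d\<close> columns an offset of
  \<open>d * m\<close>, which brings the text into the form of the two shift lemmas.\<close>

lemma window_shift: "(\<lambda>e. window x y (d * m + e)) = window (x + d) y"
  using m by (simp add: window_def fun_eq_iff add.assoc)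

lemma op_matches_window:
  "(x, y) \<in> op_matches n m T P \<longleftrightarrow>
    1 \<le> x \<and> x + m \<le> n + 1 \<and> 1 \<le> y \<and> y + m \<le> n + 1 \<and> block_iso (m * m) pat (window x y)"
proof -
  have "(\<lambda>e. substring2 T x y (e div m + 1) (e mod m + 1)) = window x y"
    "(\<lambda>e. P (e div m + 1) (e mod m + 1)) = pat"
    by (simp_all add: fun_eq_iff substring2_def window_def pat_def)
  then have "order_iso m m (substring2 T x y) P \<longleftrightarrow> block_iso (m * m) pat (window x y)"
    using order_iso_eq_block_iso[OF m, of "substring2 T x y" P] by simp
  then show ?thesis by (simp add: op_matches_def)
qed

definition searchable :: "state \<Rightarrow> bool" where
  "searchable s \<longleftrightarrow> ready s \<and> (\<forall>d\<le>m. prefix_at d (arrays s ''Z'' d))"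

lemma searchable_frame:
  assumes "frame c s s'" "searchable s" "{''n'', ''m'', ''M''} \<inter> written_vars c = {}"
    "{''S'', ''P'', ''Q'', ''Z''} \<inter> written_arrays c = {}"
  shows "searchable s'"
  using ready_frame[OF assms(1) _ assms(3)] assms frame_array[OF assms(1), of "''Z''"]
  by (auto simp: searchable_def)

lemma searchable_base: "searchable s \<Longrightarrow> base s"
  by (simp add: searchable_def ready_def)

lemma text_entry_val:
  assumes base: "base s" and x: "1 \<le> vars s ''x''" "vars s ''x'' + j \<le> n"
    and y: "1 \<le> vars s ''y''" "vars s ''y'' + m \<le> n + 1" and j: "j < m" and v: "vars s v < Suc j * m"
  shows "entry_val inp W (text_entry (Var v)) s = Some (window (vars s ''x'') (vars s ''y'') (vars s v))"
proof -
  let ?x = "vars s ''x''" and ?y = "vars s ''y''" and ?e = "vars s v"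
  have "?e div m < Suc j" using v by (simp only: less_mult_imp_div_less)
  then have col: "?x + ?e div m \<le> n" using x(2) by linarith
  have "?e mod m < m" using m by simp
  then have row: "?y + ?e mod m \<le> n" using y(2) by linarith
  have "Suc j * m \<le> m * m" using j by (intro mult_le_mono1) simp
  then have e: "?e < m * m" using v by linarith
  have "word W (?x + ?e div m) = Some (?x + ?e div m)" "word W (?y + ?e mod m) = Some (?y + ?e mod m)"
    "word W (?e div m) = Some (?e div m)" "word W (?e mod m) = Some (?e mod m)"
    "word W m = Some m" "word W ?x = Some ?x" "word W ?y = Some ?y" "word W ?e = Some ?e"
    by (rule word_ok; use col row e bound in linarith)+
  then show ?thesis
    using base_vars[OF base] col row x(1) y(1)
    by (simp add: text_entry_def lookup_def window_def)
qed

text \<open>Since \<open>j \<le> m\<close>, the guard fails at \<open>d = m\<close> at the latest,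
  so the table is never read beyond \<open>m\<close>. The alternative \<open>d = 1\<close> or
  \<open>d \<le> j\<close> bounds the shift by \<open>m\<close>, which keeps \<open>x\<close> within
  \<open>n + 1\<close>.\<close>

lemma wp_shift_scan:
  assumes s: "searchable s" and j: "vars s ''j'' \<le> m"
    and Q: "\<And>t s'. frame shift_scan s s' \<Longrightarrow> t \<le> 30 * m \<Longrightarrow>
      1 \<le> vars s' ''d'' \<Longrightarrow> (vars s' ''d'' = 1 \<or> vars s' ''d'' \<le> vars s ''j'') \<Longrightarrow>
      vars s ''j'' \<le> vars s' ''d'' + arrays s ''Z'' (vars s' ''d'') \<Longrightarrow>
      (\<And>d. 1 \<le> d \<Longrightarrow> d < vars s' ''d'' \<Longrightarrow> d + arrays s ''Z'' d < vars s ''j'') \<Longrightarrow> Q t s'"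
  shows "wp inp W shift_scan s Q"
proof -
  define j' Z where "j' = vars s ''j''" and "Z = arrays s ''Z''"
  have j': "j' \<le> m" using j by (simp add: j'_def)
  let ?b = "Less (Bin Add (Var ''d'') (Elem ''Z'' (Var ''d''))) (Var ''j'')"
  let ?s = "s\<lparr>vars := (vars s)(''d'' := 1)\<rparr>"
  have Z: "Z d \<le> m" if "d \<le> m" for d
  proof -
    have "prefix_at d (Z d)" using s that unfolding searchable_def Z_def by blast
    then show ?thesis unfolding prefix_at_def by linarith
  qed
  have words: "1 < W" "j' < W" using bound j' by auto
  have guard: "bval inp W ?b s' = Some (vars s' ''d'' + Z (vars s' ''d'') < j')"
    if "frame (While ?b (incr ''d'')) ?s s'" "vars s' ''d'' \<le> m" for s'
  proof -
    have "vars s' ''j'' = j'" "arrays s' ''Z'' = Z"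
      using frame_var[OF that(1), of "''j''"] frame_array[OF that(1), of "''Z''"]
      by (simp_all add: j'_def Z_def)
    moreover have "vars s' ''d'' < W" "Z (vars s' ''d'') < W" "vars s' ''d'' + Z (vars s' ''d'') < W"
      using Z[OF that(2)] that(2) bound by linarith+
    ultimately show ?thesis using words by (simp add: word_ok)
  qed
  have "wp inp W (While ?b (incr ''d'')) ?s (\<lambda>t s'. t \<le> 20 * m \<and>
      1 \<le> vars s' ''d'' \<and> (vars s' ''d'' = 1 \<or> vars s' ''d'' \<le> j') \<and>
      j' \<le> vars s' ''d'' + Z (vars s' ''d'') \<and>
      (\<forall>d. 1 \<le> d \<longrightarrow> d < vars s' ''d'' \<longrightarrow> d + Z d < j'))"
  proof (rule wp_While[where B = 4 and \<mu> = "\<lambda>s'. m - vars s' ''d''"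
        and Inv = "\<lambda>s'. 1 \<le> vars s' ''d'' \<and> vars s' ''d'' \<le> m \<and> (vars s' ''d'' = 1 \<or> vars s' ''d'' \<le> j') \<and>
          (\<forall>d. 1 \<le> d \<longrightarrow> d < vars s' ''d'' \<longrightarrow> d + Z d < j')"], goal_cases)
    case 1
    then show ?case using m by simp
  next
    case (2 s')
    then show ?case using guard[of s'] unfolding frame_While by simp
  next
    case (3 s')
    have less: "vars s' ''d'' + Z (vars s' ''d'') < j'" using 3 guard[of s'] unfolding frame_While by auto
    then have "vars s' ''d'' < m" "vars s' ''d'' < W" "Suc (vars s' ''d'') < W"
      "m - Suc (vars s' ''d'') < m - vars s' ''d''"
      using j' bound by linarith+
    then show ?case using 3(2) less words by (auto simp: wp_simps word_ok less_Suc_eq)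
  next
    case (4 t s')
    have "\<not> vars s' ''d'' + Z (vars s' ''d'') < j'" using 4 guard[of s'] unfolding frame_While by auto
    moreover have "t \<le> 20 * m" using 4(4) m by simp
    ultimately show ?case using 4(2) by simp
  qed
  then have "wp inp W shift_scan s (\<lambda>t s'. t \<le> 30 * m \<and>
      1 \<le> vars s' ''d'' \<and> (vars s' ''d'' = 1 \<or> vars s' ''d'' \<le> j') \<and>
      j' \<le> vars s' ''d'' + Z (vars s' ''d'') \<and>
      (\<forall>d. 1 \<le> d \<longrightarrow> d < vars s' ''d'' \<longrightarrow> d + Z d < j'))"
    unfolding shift_scan_def using words m
    by (simp add: wp_simps word_ok) (erule wp_mono, simp)
  then show ?thesis
    by (rule wp_mono) (use Q in \<open>simp add: j'_def Z_def\<close>)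
qed

section \<open>Reporting the matches of one strip\<close>

definition occurrences :: "nat \<Rightarrow> nat \<Rightarrow> (nat \<times> nat) set" where
  "occurrences x y = {(x', y'). (x', y') \<in> op_matches n m T P \<and> y' = y \<and> x' < x}"

definition strip_inv :: "nat \<Rightarrow> (nat \<times> nat) set \<Rightarrow> state \<Rightarrow> bool" where
  "strip_inv y R s \<longleftrightarrow> searchable s \<and> vars s ''y'' = y \<and>
     1 \<le> vars s ''x'' \<and> vars s ''x'' \<le> n + 1 \<and> vars s ''j'' \<le> m \<and>
     block_iso (vars s ''j'' * m) pat (window (vars s ''x'') y) \<and>
     set (reported s) = R \<union> occurrences (vars s ''x'') y"

text \<open>For each skipped shift the overlap ends inside the matched part, so
  \<open>shift_mismatch\<close> rules out a match there; between \<open>x\<close> and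
  \<open>x + d\<close> only \<open>x\<close> itself remains to be decided.\<close>

lemma occurrences_shift:
  assumes s: "searchable s" and j: "j \<le> m" and d: "1 \<le> d"
    and matched: "block_iso (j * m) pat (window x y)"
    and skip: "\<And>d'. 1 \<le> d' \<Longrightarrow> d' < d \<Longrightarrow> d' + arrays s ''Z'' d' < j"
  shows "occurrences (x + d) y = occurrences x y \<union> ({(x, y)} \<inter> op_matches n m T P)"
proof -
  have skipped: "(x + d', y) \<notin> op_matches n m T P" if d': "1 \<le> d'" "d' < d" for d'
  proof -
    have less: "d' + arrays s ''Z'' d' < j" using skip[OF d'] .
    then have "prefix_at d' (arrays s ''Z'' d')" using s j by (simp add: searchable_def)
    then have "\<not> block_iso (Suc (arrays s ''Z'' d') * m) pat (\<lambda>e. pat (d' * m + e))"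
      using less j unfolding prefix_at_def shifted_def[abs_def] by simp
    from shift_mismatch[OF matched this less j] show ?thesis
      unfolding op_matches_window window_shift by blast
  qed
  have "(a, y) \<notin> op_matches n m T P" if "x < a" "a < x + d" for a
  proof -
    obtain d' where "0 < d'" "x + d' = a" using less_imp_add_positive[OF \<open>x < a\<close>] by blast
    then show ?thesis using skipped[of d'] \<open>a < x + d\<close> by auto
  qed
  moreover have "a < x + d \<longleftrightarrow> a < x \<or> a = x \<or> (x < a \<and> a < x + d)" for a
    using d by linarith
  ultimately show ?thesis unfolding occurrences_def by blast
qed

text \<open>The loop terminates in time because \<open>2 * x + j\<close> grows: a successful test increments \<open>j\<close>, and a
  shift adds \<open>d\<close> to \<open>x\<close> while taking at most \<open>d\<close> from \<open>j\<close>.\<close>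

lemma wp_search_step:
  assumes inv: "strip_inv y R s" and y: "1 \<le> y" "y + m \<le> n + 1" and x: "vars s ''x'' + m \<le> n + 1"
  shows "wp inp W search_step s (\<lambda>t s'. t \<le> 700 * m \<and> strip_inv y R s' \<and>
     2 * vars s ''x'' + vars s ''j'' < 2 * vars s' ''x'' + vars s' ''j'')"
proof -
  define x' j' where "x' = vars s ''x''" and "j' = vars s ''j''"
  have s: "searchable s" and vy: "vars s ''y'' = y" and x1: "1 \<le> x'" and j: "j' \<le> m"
    and matched: "block_iso (j' * m) pat (window x' y)"
    and rep: "set (reported s) = R \<union> occurrences x' y"
    using inv by (simp_all add: strip_inv_def x'_def j'_def)
  have words: "0 < W" "1 < W" "x' < W" "y < W" "j' < W" "m < W" "Suc j' < W" "n < W"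
    using bound x y j unfolding x'_def by linarith+
  let ?test = "If (Less (Var ''j'') (Var ''m'')) (column_test text_entry) Skip"
  let ?s = "s\<lparr>vars := (vars s)(''o'' := 0)\<rparr>"
  have test: "wp inp W ?test ?s (\<lambda>t s1. t \<le> 600 * m + 5 \<and> searchable s1 \<and>
     vars s1 ''y'' = y \<and> vars s1 ''x'' = x' \<and> vars s1 ''j'' = j' \<and> reported s1 = reported s \<and>
     (if j' < m \<and> block_iso (Suc j' * m) pat (window x' y) then vars s1 ''o'' = 1 else vars s1 ''o'' = 0))"
  proof (cases "j' < m")
    case False
    then show ?thesis
      using words s vy base_vars[OF searchable_base[OF s]]
      by (simp add: wp_simps word_ok x'_def[symmetric] j'_def[symmetric]
          searchable_def ready_def base_def sorted_pat_def links_def sorted_list_def)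
  next
    case True
    have s': "searchable ?s"
      using s by (simp add: searchable_def ready_def base_def sorted_pat_def links_def sorted_list_def)
    then have ready: "base ?s" "sorted_pat ?s" "links ?s" by (simp_all add: searchable_def ready_def)
    have "wp inp W (column_test text_entry) ?s (\<lambda>t s1. t \<le> 600 * m \<and> searchable s1 \<and>
       vars s1 ''y'' = y \<and> vars s1 ''x'' = x' \<and> vars s1 ''j'' = j' \<and> reported s1 = reported s \<and>
       vars s1 ''o'' = (if block_iso (Suc j' * m) pat (window x' y) then 1 else 0))"
    proof (rule wp_column_test[OF ready, where B = "window x' y"], goal_cases)
      case (3 s1 v)
      have "base s1" using base_frame[OF 3(1) ready(1)] by (simp add: writes_column_test)
      moreover have "vars s1 ''x'' = x'" "vars s1 ''y'' = y"
        using frame_var[OF 3(1), of "''x''"] frame_var[OF 3(1), of "''y''"] vy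
        by (simp_all add: writes_column_test x'_def)
      ultimately show ?case
        using text_entry_val[of s1 j' v] 3(2) x1 x y True unfolding x'_def[symmetric] j'_def[symmetric]
        by (simp add: j'_def[symmetric])
    next
      case (5 t s1)
      have "vars s1 v = vars s v" if "v \<in> {''x'', ''y'', ''j''}" for v
        using frame_var[OF 5(1), of v] that by (auto simp: writes_column_test)
      moreover have "reported s1 = reported s"
        using frame_reported[OF 5(1)] by (simp add: writes_column_test)
      moreover have "searchable s1"
        using searchable_frame[OF 5(1) s'] by (simp add: writes_column_test)
      ultimately show ?case
        using 5(2,3) vy by (simp add: x'_def j'_def)
    qed (use True matched in \<open>simp_all add: text_entry_def j'_def[symmetric]\<close>)
    then show ?thesis
      using words True base_vars[OF searchable_base[OF s]]
      by (simp add: wp_simps word_ok j'_def[symmetric]) (erule wp_mono, simp)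
  qed
  let ?shift = "Seq shift_scan
            (Seq (Assign ''x'' (Bin Add (Var ''x'') (Var ''d'')))
                 (Assign ''j'' (Bin Sub (Var ''j'') (Var ''d''))))"
  let ?progress = "\<lambda>s'. strip_inv y R s' \<and> 2 * x' + j' < 2 * vars s' ''x'' + vars s' ''j''"
  have shift: "wp inp W ?shift s2 (\<lambda>t s'. t \<le> 30 * m + 12 \<and> ?progress s')"
    if s2: "searchable s2" and v: "vars s2 ''x'' = x'" "vars s2 ''y'' = y" "vars s2 ''j'' = j'"
      and rep2: "set (reported s2) = R \<union> occurrences x' y \<union> ({(x', y)} \<inter> op_matches n m T P)" for s2
    unfolding wp_Seq
  proof (rule wp_shift_scan[OF s2], goal_cases)
    case 1
    then show ?case using v j by simp
  next
    case (2 t s3)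
    define d where "d = vars s3 ''d''"
    have v3: "vars s3 ''x'' = x'" "vars s3 ''y'' = y" "vars s3 ''j'' = j'"
      using frame_var[OF 2(1)] v by (simp_all add: writes_search)
    have d: "1 \<le> d" "d = 1 \<or> d \<le> j'" "j' \<le> d + arrays s2 ''Z'' d"
      using 2(3,4,5) v by (simp_all add: d_def)
    then have dm: "d \<le> m" using j m by auto
    have x2: "x' + d \<le> n + 1" using x dm by (simp add: x'_def)
    have words3: "d < W" "x' + d < W" "j' - d < W" using dm x2 bound words(5) by linarith+
    have s3: "searchable s3" using searchable_frame[OF 2(1) s2] by (simp add: writes_search)
    have "reported s3 = reported s2" using frame_reported[OF 2(1)] by (simp add: writes_search)
    then have rep3: "set (reported s3) = R \<union> occurrences (x' + d) y"
      using rep2 occurrences_shift[OF s2 j d(1) matched] 2(6) v by (simp add: d_def Un_assoc)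
    have "prefix_at d (arrays s2 ''Z'' d)" using s2 dm by (simp add: searchable_def)
    then have "block_iso ((j' - d) * m) pat (\<lambda>e. window x' y (d * m + e))"
      using shift_matched[OF matched _ d(3)] by (simp add: prefix_at_def shifted_def[abs_def])
    then have matched': "block_iso ((j' - d) * m) pat (window (x' + d) y)"
      unfolding window_shift .
    have "strip_inv y R (s3\<lparr>vars := (vars s3)(''x'' := x' + d, ''j'' := j' - d)\<rparr>)"
      using s3 v3(2) x1 x2 j matched' rep3
      by (simp add: strip_inv_def searchable_def ready_def base_def sorted_pat_def links_def sorted_list_def)
    moreover have "2 * x' + j' < 2 * (x' + d) + (j' - d)" using d(1,2) by auto
    ultimately show ?case
      using words words3 v3 2(2) by (simp add: wp_simps word_ok d_def[symmetric])
  qed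
  let ?rest = "If (Less (Const 0) (Var ''o'')) (incr ''j'')
     (Seq (If (Less (Var ''j'') (Var ''m'')) Skip (Report (Var ''x'') (Var ''y''))) ?shift)"
  have rest: "wp inp W ?rest s1 (\<lambda>t s'. t \<le> 30 * m + 30 \<and> ?progress s')"
    if s1: "searchable s1" and v: "vars s1 ''x'' = x'" "vars s1 ''y'' = y" "vars s1 ''j'' = j'"
      and rep1: "reported s1 = reported s"
      and o: "if j' < m \<and> block_iso (Suc j' * m) pat (window x' y) then vars s1 ''o'' = 1 else vars s1 ''o'' = 0"
    for s1
  proof (cases "j' < m \<and> block_iso (Suc j' * m) pat (window x' y)")
    case True
    then have "strip_inv y R (s1\<lparr>vars := (vars s1)(''j'' := Suc j')\<rparr>)"
      using s1 v x1 x rep rep1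
      by (simp add: strip_inv_def searchable_def ready_def base_def sorted_pat_def links_def
          sorted_list_def x'_def)
    then show ?thesis using True o v words by (simp add: wp_simps word_ok)
  next
    case False
    have vm: "vars s1 ''m'' = m" using base_vars(2)[OF searchable_base[OF s1]] .
    show ?thesis
    proof (cases "j' < m")
      case True
      have "\<not> block_iso (m * m) pat (window x' y)"
        using block_iso_antimono[of "m * m" pat "window x' y" "Suc j' * m"] True False
          mult_le_mono1[of "Suc j'" m m] by auto
      then have "(x', y) \<notin> op_matches n m T P" by (simp add: op_matches_window)
      then have "wp inp W ?shift s1 (\<lambda>t s'. t \<le> 30 * m + 12 \<and> ?progress s')"
        by (intro shift s1 v) (simp add: rep1 rep)
      then show ?thesis
        using o False True v vm words
        by (simp add: wp_If wp_Seq_If wp_Skip word_ok) (erule wp_mono, simp)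
    next
      case False
      then have "(x', y) \<in> op_matches n m T P"
        using matched j x1 x y by (simp add: op_matches_window x'_def)
      then have "wp inp W ?shift (s1\<lparr>reported := (x', y) # reported s1\<rparr>)
          (\<lambda>t s'. t \<le> 30 * m + 12 \<and> ?progress s')"
        using s1 v
        by (intro shift) (auto simp: rep1 rep searchable_def ready_def base_def sorted_pat_def links_def
            sorted_list_def)
      then show ?thesis
        using o False v vm words
        by (simp add: wp_If wp_Seq_If wp_Report word_ok) (erule wp_mono, simp)
    qed
  qed
  have "wp inp W ?test ?s (\<lambda>t1 s1. wp inp W ?rest s1 (\<lambda>t2 s'. 4 + t1 + t2 \<le> 700 * m \<and> ?progress s'))"
  proof (rule wp_mono[OF test], elim conjE, goal_cases)
    case (1 t1 s1)
    then show ?case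
      by (intro wp_mono[OF rest]) (use m in auto)
  qed
  then show ?thesis
    unfolding search_step_def using words
    by (simp add: wp_Seq_Assign wp_Seq_If wp_Assign word_ok
        x'_def[symmetric] j'_def[symmetric] numeral_eq_Suc)
qed

lemma wp_search_strip:
  assumes s: "searchable s" and y: "vars s ''y'' = y" "1 \<le> y" "y + m \<le> n + 1"
  shows "wp inp W search_strip s (\<lambda>t s'. t \<le> 2300 * (n * m) \<and>
     set (reported s') = set (reported s) \<union> occurrences (Suc n) y)"
proof -
  let ?b = "Less (Bin Add (Var ''x'') (Var ''m'')) (Bin Add (Var ''n'') (Const 2))"
  let ?s = "s\<lparr>vars := (vars s)(''x'' := 1, ''j'' := 0)\<rparr>"
  let ?R = "set (reported s)"
  have words: "0 < W" "1 < W" "2 < W" "m < W" "n < W" "n + 2 < W" using bound by linarith+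
  have nm: "1 \<le> n * m" "m \<le> n * m" "n \<le> n * m" using n m by simp_all
  have guard: "bval inp W ?b s' = Some (vars s' ''x'' + m < n + 2)" if "strip_inv y ?R s'" for s'
  proof -
    have "vars s' ''x'' < W" "vars s' ''x'' + m < W"
      using that bound unfolding strip_inv_def by linarith+
    then show ?thesis
      using words base_vars[OF searchable_base, of s'] that by (simp add: strip_inv_def word_ok)
  qed
  have "wp inp W (While ?b search_step) ?s (\<lambda>t s'. t \<le> 2250 * (n * m) \<and>
     set (reported s') = ?R \<union> occurrences (Suc n) y)"
  \<comment> \<open>While the guard holds, \<open>2 * x + j \<le> 2 * n + 2 - m\<close>, so the
    truncated difference is positive and really falls. It starts at \<open>2 * n + 1\<close>, which
    bounds the number of steps in a strip.\<close>
  proof (rule wp_While[where B = "700 * m" and Inv = "strip_inv y ?R"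
        and \<mu> = "\<lambda>s'. 2 * n + 3 - (2 * vars s' ''x'' + vars s' ''j'')"], goal_cases)
    case 1
    have "occurrences 1 y = {}" by (auto simp: occurrences_def op_matches_def)
    then show ?case
      using s y by (simp add: strip_inv_def searchable_def ready_def base_def sorted_pat_def links_def
          sorted_list_def block_iso_0)
  next
    case (2 s')
    then show ?case using guard by simp
  next
    case (3 s')
    have x: "vars s' ''x'' + m \<le> n + 1" using 3(3) guard[OF 3(2)] by simp
    have "vars s' ''j'' \<le> m" using 3(2) by (simp add: strip_inv_def)
    then show ?case
      using x by (intro wp_mono[OF wp_search_step[OF 3(2) y(2,3) x]]) auto
  next
    case (4 t s')
    have x: "\<not> vars s' ''x'' + m < n + 2" using 4(3) guard[OF 4(2)] by simp
    \<comment> \<open>No match starts beyond \<open>n + 1 - m\<close>, so the exact value of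
      \<open>x\<close> on leaving the loop is irrelevant.\<close>
    have "occurrences (vars s' ''x'') y = occurrences (Suc n) y"
      using x m by (auto simp: occurrences_def op_matches_def)
    moreover have "t \<le> 1400 * (n * m) + 16 * n + 700 * m + 16"
      using 4(4) by (simp add: algebra_simps)
    then have "t \<le> 2250 * (n * m)" using nm by linarith
    ultimately show ?case using 4(2) by (simp add: strip_inv_def)
  qed
  then show ?thesis
    unfolding search_strip_def using words
    by (simp add: wp_simps word_ok)
      (erule wp_mono, elim conjE, intro conjI; (assumption | use nm in linarith))
qed

lemma wp_search:
  assumes s: "searchable s" and rep: "reported s = []"
  shows "wp inp W search s (\<lambda>t s'. t \<le> 2500 * (n * n * m) \<and>
     set (reported s') = op_matches n m T P)"
proof -
  let ?b = "Less (Bin Add (Var ''y'') (Var ''m'')) (Bin Add (Var ''n'') (Const 2))"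
  let ?loop = "While ?b (Seq search_strip (incr ''y''))"
  let ?s = "s\<lparr>vars := (vars s)(''y'' := 1)\<rparr>"
  let ?found = "\<lambda>y. {(a, b). (a, b) \<in> op_matches n m T P \<and> b < y}"
  have words: "0 < W" "1 < W" "2 < W" "m < W" "n < W" "n + 2 < W" using bound by linarith+
  have nm: "1 \<le> n * n * m" "m \<le> n * n * m" "n \<le> n * n * m" using n m by simp_all
  have s1: "searchable ?s"
    using s by (simp add: searchable_def ready_def base_def sorted_pat_def links_def sorted_list_def)
  have searchable: "searchable s'" if "frame ?loop ?s s'" for s'
    using searchable_frame[OF that s1] by (simp add: writes_search)
  have guard: "bval inp W ?b s' = Some (vars s' ''y'' + m < n + 2)"
    if "frame ?loop ?s s'" "vars s' ''y'' \<le> n + 1" for s'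
  proof -
    have "vars s' ''y'' < W" "vars s' ''y'' + m < W" using that(2) bound by linarith+
    then show ?thesis
      using words base_vars[OF searchable_base[OF searchable[OF that(1)]]] by (simp add: word_ok)
  qed
  have "wp inp W ?loop ?s (\<lambda>t s'. t \<le> 2400 * (n * n * m) \<and> set (reported s') = op_matches n m T P)"
  proof (rule wp_While[where B = "2300 * (n * m) + 5" and \<mu> = "\<lambda>s'. n + 2 - (vars s' ''y'' + m)"
        and Inv = "\<lambda>s'. 1 \<le> vars s' ''y'' \<and> vars s' ''y'' \<le> n + 1 \<and>
          set (reported s') = ?found (vars s' ''y'')"], goal_cases)
    case 1
    have "?found 1 = {}" by (auto simp: op_matches_def)
    then show ?case using rep by simp
  next
    case (2 s')
    then show ?case using guard[of s'] unfolding frame_While by simp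
  next
    case (3 s')
    define y where "y = vars s' ''y''"
    have y: "1 \<le> y" "y + m \<le> n + 1" using 3 guard[of s'] unfolding frame_While y_def by auto
    have words': "y < W" "Suc y < W" "Suc y \<le> n + 1" "n + 2 - (Suc y + m) < n + 2 - (y + m)"
      using y m bound by linarith+
    have s': "searchable s'" using 3(1) searchable unfolding frame_While by simp
    have found: "?found (Suc y) = ?found y \<union> occurrences (Suc n) y"
      using m by (auto simp: occurrences_def op_matches_def less_Suc_eq)
    show ?case
      unfolding wp_Seq
    proof (rule wp_mono[OF wp_search_strip[OF s' y_def[symmetric] y]], goal_cases)
      case (1 t s2)
      have "vars s2 ''y'' = y" using frame_var[OF 1(1)] by (simp add: writes_search y_def)
      then show ?case
        using 1(2) words words' 3(2) found y by (simp add: wp_simps word_ok y_def[symmetric])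
    qed
  next
    case (4 t s')
    have y: "\<not> vars s' ''y'' + m < n + 2" using 4 guard[of s'] unfolding frame_While by auto
    have all: "?found (vars s' ''y'') = op_matches n m T P" using y by (auto simp: op_matches_def)
    \<comment> \<open>The number of strips; it is 0 by truncation when the pattern is larger than
      the text.\<close>
    have "n + 2 - (1 + m) \<le> n" using m by simp
    then have "(n + 2 - (1 + m)) * (13 + 2300 * (n * m)) \<le> n * (13 + 2300 * (n * m))"
      by (rule mult_le_mono1)
    moreover have "t \<le> (n + 2 - (1 + m)) * (13 + 2300 * (n * m)) + 8" using 4(4) by (simp add: add.commute)
    ultimately have "t \<le> n * (13 + 2300 * (n * m)) + 8" by linarith
    then have "t \<le> 2300 * (n * n * m) + 13 * n + 8" by (simp add: algebra_simps)
    then have "t \<le> 2400 * (n * n * m)" using nm by linarith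
    then show ?case using 4(2) all by simp
  qed
  then show ?thesis
    unfolding search_def using words
    by (simp add: wp_simps word_ok)
      (erule wp_mono, elim conjE, intro conjI; (assumption | use nm in linarith))
qed

section \<open>The complete program and its word size\<close>

lemma wp_oppm_program:
  assumes start: "vars s ''n'' = n" "vars s ''m'' = m" and rep: "reported s = []"
  shows "wp inp W oppm_program s (\<lambda>t s'. t \<le> 4000 * (n * n * m + m * m * m) \<and>
     set (reported s') = op_matches n m T P)"
  unfolding oppm_program_def wp_Seq
proof (rule wp_sort_pattern[OF start], goal_cases)
  case (1 t1 s1)
  have mmm: "1 \<le> m * m * m" using m by simp
  show ?case
  proof (rule wp_link_columns[OF 1(3,4)], goal_cases)
    case A: (1 t2 s2)
    have "ready s2"
      using base_frame[OF A(1) 1(3)] frame_array[OF A(1), of "''S''"] 1(4) A(3)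
      by (simp add: ready_def writes_link sorted_pat_def)
    then show ?case
    proof (rule wp_prefix_table, goal_cases)
      case B: (1 t3 s3)
      have "searchable s3"
        using ready_frame[OF B(1) \<open>ready s2\<close>] B(3) by (simp add: searchable_def writes_prefix)
      moreover have "reported s3 = []"
        using rep frame_reported[OF 1(1)] frame_reported[OF A(1)] frame_reported[OF B(1)]
        by (simp add: writes_sort writes_link writes_prefix)
      ultimately have "wp inp W search s3 (\<lambda>t s'. t \<le> 2500 * (n * n * m) \<and>
          set (reported s') = op_matches n m T P)"
        by (rule wp_search)
      then show ?case
      proof (rule wp_mono)
        fix t s'
        assume found: "t \<le> 2500 * (n * n * m) \<and> set (reported s') = op_matches n m T P"
        \<comment> \<open>With \<open>v\<close> standing for the cube of \<open>m\<close>, the three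
          preparations sum to at most \<open>3700 * v\<close>, and \<open>1 \<le> v\<close> absorbs
          the three sequencing steps.\<close>
        have "1 + a + (1 + b + (1 + c + d)) \<le> 4000 * (u + v)"
          if "a \<le> 500 * v" "b \<le> 200 * v" "c \<le> 3000 * v" "1 \<le> v" "d \<le> 2500 * u" for a b c d u v :: nat
          using that by simp
        from this[OF 1(2) A(2) B(2) mmm conjunct1[OF found]]
        show "1 + t1 + (1 + t2 + (1 + t3 + t)) \<le> 4000 * (n * n * m + m * m * m) \<and>
            set (reported s') = op_matches n m T P"
          using found by blast
      qed
    qed
  qed
qed

end

text \<open>The left side is below \<open>2 ^ 5\<close> times the square of \<open>n + m\<close>. As
  \<open>n + m \<ge> 2\<close>, five further powers absorb the constant, even in the smallest case,
  hence the exponent 7.\<close>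

lemma word_bound:
  fixes n m :: nat
  assumes "1 \<le> n" "1 \<le> m"
  shows "m * m + 2 * n + 3 * m + 10 < (n + m) ^ 7"
proof -
  let ?N = "n + m"
  have N: "2 \<le> ?N" using assms by simp
  have "m * m \<le> ?N ^ 2" by (simp add: power2_eq_square mult_mono)
  moreover have "3 * ?N \<le> 2 * ?N ^ 2"
    using mult_le_mono1[OF N, of ?N] unfolding power2_eq_square by linarith
  moreover have "2 * 2 \<le> ?N ^ 2" unfolding power2_eq_square by (rule mult_le_mono[OF N N])
  ultimately have "m * m + 2 * n + 3 * m + 10 < 2 ^ 5 * ?N ^ 2" by simp
  also have "\<dots> \<le> ?N ^ 5 * ?N ^ 2" by (intro mult_le_mono1 power_mono N) simp
  also have "\<dots> = ?N ^ 7" by (simp flip: power_add)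
  finally show ?thesis .
qed

theorem theorem3:
  shows "\<exists>prog. solves_oppm2_in_time prog (\<lambda>n m. n ^ 2 * m + m ^ 3)"
proof
  show "solves_oppm2_in_time oppm_program (\<lambda>n m. n ^ 2 * m + m ^ 3)"
    unfolding solves_oppm2_in_time_def Let_def
  proof (rule exI[of _ 4000], rule exI[of _ 7], intro allI impI)
    fix n m :: nat and T P :: string2
    assume "1 \<le> n" "1 \<le> m"
    then interpret oppm n m "(n + m) ^ 7" T P
      using word_bound by unfold_locales
    obtain t s where "exec inp ((n + m) ^ 7) oppm_program (init_state inp) t s"
      "t \<le> 4000 * (n * n * m + m * m * m)" "set (reported s) = op_matches n m T P"
      using wp_oppm_program[of "init_state inp"] unfolding wp_def by (auto simp: init_state_def)
    then show "\<exists>t s. exec inp ((n + m) ^ 7) oppm_program (init_state inp) t s \<and>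
        t \<le> 4000 * (n ^ 2 * m + m ^ 3) \<and> set (reported s) = op_matches n m T P"
      by (auto simp: power2_eq_square power3_eq_cube)
  qed
qed

end
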